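(* There exist universal constants $C,C'>0$ such that the following holds. Let $P$ be an irreducible, aperiodic transition matrix on a finite set $G$ with $|G|\ge2$, reversible with respect to the probability measure $\pi$. Then for every nonempty $S\subset G$ and every $x\in S$, $$h_S(x)\le \frac{C}{u(P)(1-\lambda)}\,\pi(x)\Big(\log(2e/\pi_{\min})\vee \pi(S)^{-1}\Big)\le \frac{C'\pi_{\max}}{(1-\lambda)^2\pi_{\min}}\,\pi(x)\Big(\log(2e/\pi_{\min})\vee\pi(S)^{-1}\Big).$$ In particular, for simple random walk on a finite connected regular graph $G$ with $N=|G|\ge2$ vertices (with $1-\lambda$ the spectral gap of its lazy version if the walk is periodic), $$h_S(x)\le \frac{C}{u(P)(1-\lambda)}\Big(\frac1{|S|}\vee\frac{\log N}{N}\Big)\le\frac{C'}{(1-\lambda)^2}\Big(\frac1{|S|}\vee\frac{\log N}{N}\Big).$$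
   Context: $(X_t)$ is the chain with transition matrix $P$. $\lambda=\max_{j>1}|\lambda_j|$, where $1=\lambda_1>\lambda_2\ge\dots\ge\lambda_n>-1$ are the eigenvalues of $P$. $\pi_{\min}=\min_x\pi(x)$, $\pi_{\max}=\max_x\pi(x)$, and $a\vee b=\max\{a,b\}$. For $A\subset G$, $T_A=\inf\{t\ge0:X_t\in A\}$ and $T_A^+=\inf\{t\ge1:X_t\in A\}$. $u(P):=\min_{x\ne y}\Pr_x[T_y<T_x^+]$. The harmonic measure on $S$ from $y$ is $h_{y,S}(x)=\Pr_y[X_{T_S}=x]$, and $h_S(x)=\sum_y\pi(y)h_{y,S}(x)$ is the harmonic measure from stationarity. Harmonic measure is unchanged when $P$ is replaced by the lazy chain $\frac12(I+P)$, which changes the spectral gap by at most a factor of $2$. *)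

theory Defs
  imports Complex_Main "Jordan_Normal_Form.Char_Poly"
begin

text \<open>Finite state space G = {..<n}; a transition matrix is a function P :: nat => nat => real
  (only its values on {..<n} x {..<n} matter).\<close>

definition stochastic :: "nat \<Rightarrow> (nat \<Rightarrow> nat \<Rightarrow> real) \<Rightarrow> bool" where
  "stochastic n P \<longleftrightarrow> (\<forall>x<n. \<forall>y<n. P x y \<ge> 0) \<and> (\<forall>x<n. (\<Sum>y<n. P x y) = 1)"

fun mpow :: "nat \<Rightarrow> (nat \<Rightarrow> nat \<Rightarrow> real) \<Rightarrow> nat \<Rightarrow> nat \<Rightarrow> nat \<Rightarrow> real" where
  "mpow n P 0 x y = (if x = y then 1 else 0)"
| "mpow n P (Suc t) x y = (\<Sum>z<n. P x z * mpow n P t z y)"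

definition irreducible_chain :: "nat \<Rightarrow> (nat \<Rightarrow> nat \<Rightarrow> real) \<Rightarrow> bool" where
  "irreducible_chain n P \<longleftrightarrow> (\<forall>x<n. \<forall>y<n. \<exists>t. mpow n P t x y > 0)"

definition aperiodic_chain :: "nat \<Rightarrow> (nat \<Rightarrow> nat \<Rightarrow> real) \<Rightarrow> bool" where
  "aperiodic_chain n P \<longleftrightarrow> (\<forall>x<n. Gcd {t. t \<ge> 1 \<and> mpow n P t x x > 0} = 1)"

definition prob_on :: "nat \<Rightarrow> (nat \<Rightarrow> real) \<Rightarrow> bool" where
  "prob_on n \<pi> \<longleftrightarrow> (\<forall>x<n. \<pi> x \<ge> 0) \<and> (\<Sum>x<n. \<pi> x) = 1"

definition reversible :: "nat \<Rightarrow> (nat \<Rightarrow> nat \<Rightarrow> real) \<Rightarrow> (nat \<Rightarrow> real) \<Rightarrow> bool" where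
  "reversible n P \<pi> \<longleftrightarrow> (\<forall>x<n. \<forall>y<n. \<pi> x * P x y = \<pi> y * P y x)"

definition tmat :: "nat \<Rightarrow> (nat \<Rightarrow> nat \<Rightarrow> real) \<Rightarrow> real mat" where
  "tmat n P = mat n n (\<lambda>(i, j). P i j)"

text \<open>lambda = max over j>1 of |lambda_j|, eigenvalues counted with algebraic multiplicity
  (one copy of the eigenvalue 1 is removed).\<close>
definition slem :: "nat \<Rightarrow> (nat \<Rightarrow> nat \<Rightarrow> real) \<Rightarrow> real" where
  "slem n P = Max {\<bar>\<mu>\<bar> | \<mu>. eigenvalue (tmat n P) \<mu> \<and>
                     (\<mu> \<noteq> 1 \<or> order 1 (char_poly (tmat n P)) \<ge> 2)}"

definition lazy :: "(nat \<Rightarrow> nat \<Rightarrow> real) \<Rightarrow> nat \<Rightarrow> nat \<Rightarrow> real" where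
  "lazy P x y = (P x y + (if x = y then 1 else 0)) / 2"

text \<open>stay n P B t v w = Pr_v[X_0,...,X_{t-1} \<notin> B and X_t = w].\<close>
fun stay :: "nat \<Rightarrow> (nat \<Rightarrow> nat \<Rightarrow> real) \<Rightarrow> nat set \<Rightarrow> nat \<Rightarrow> nat \<Rightarrow> nat \<Rightarrow> real" where
  "stay n P B 0 v w = (if v = w then 1 else 0)"
| "stay n P B (Suc t) v w = (if v \<in> B then 0 else (\<Sum>u<n. P v u * stay n P B t u w))"

text \<open>Pr_x[T_y < T_x^+] (for x \<noteq> y): sum over t of Pr_x[X_1..X_t \<notin> {x,y} before, X_{t+1} = y].\<close>
definition escape_prob :: "nat \<Rightarrow> (nat \<Rightarrow> nat \<Rightarrow> real) \<Rightarrow> nat \<Rightarrow> nat \<Rightarrow> real" where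
  "escape_prob n P x y = (\<Sum>t. \<Sum>u<n. P x u * stay n P {x, y} t u y)"

definition uP :: "nat \<Rightarrow> (nat \<Rightarrow> nat \<Rightarrow> real) \<Rightarrow> real" where
  "uP n P = Min {escape_prob n P x y | x y. x < n \<and> y < n \<and> x \<noteq> y}"

text \<open>Harmonic measure h_{y,S}(x) = Pr_y[X_{T_S} = x], T_S = inf{t \<ge> 0. X_t \<in> S}.\<close>
definition harm :: "nat \<Rightarrow> (nat \<Rightarrow> nat \<Rightarrow> real) \<Rightarrow> nat \<Rightarrow> nat set \<Rightarrow> nat \<Rightarrow> real" where
  "harm n P y S x = (\<Sum>t. stay n P S t y x)"

definition harm_stat :: "nat \<Rightarrow> (nat \<Rightarrow> nat \<Rightarrow> real) \<Rightarrow> (nat \<Rightarrow> real) \<Rightarrow> nat set \<Rightarrow> nat \<Rightarrow> real" where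
  "harm_stat n P \<pi> S x = (\<Sum>y<n. \<pi> y * harm n P y S x)"

definition pimin :: "nat \<Rightarrow> (nat \<Rightarrow> real) \<Rightarrow> real" where
  "pimin n \<pi> = Min (\<pi> ` {..<n})"

definition pimax :: "nat \<Rightarrow> (nat \<Rightarrow> real) \<Rightarrow> real" where
  "pimax n \<pi> = Max (\<pi> ` {..<n})"

definition simple_graph :: "nat \<Rightarrow> (nat \<Rightarrow> nat \<Rightarrow> bool) \<Rightarrow> bool" where
  "simple_graph n E \<longleftrightarrow> (\<forall>x<n. \<forall>y<n. E x y \<longleftrightarrow> E y x) \<and> (\<forall>x<n. \<not> E x x)"

definition regular_graph :: "nat \<Rightarrow> (nat \<Rightarrow> nat \<Rightarrow> bool) \<Rightarrow> nat \<Rightarrow> bool" where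
  "regular_graph n E d \<longleftrightarrow> (\<forall>x<n. card {y. y < n \<and> E x y} = d)"

definition connected_graph :: "nat \<Rightarrow> (nat \<Rightarrow> nat \<Rightarrow> bool) \<Rightarrow> bool" where
  "connected_graph n E \<longleftrightarrow> (\<forall>x<n. \<forall>y<n. (\<lambda>a b. a < n \<and> b < n \<and> E a b)\<^sup>*\<^sup>* x y)"

definition srw :: "nat \<Rightarrow> (nat \<Rightarrow> nat \<Rightarrow> bool) \<Rightarrow> nat \<Rightarrow> nat \<Rightarrow> real" where
  "srw n E x y = (if y < n \<and> E x y then 1 / real (card {z. z < n \<and> E x z}) else 0)"

end

theory Submission
  imports Defs "HOL-Analysis.Function_Topology"
begin

text \<open>
Let \<open>w(y) = E\<^sub>y[T\<^sub>S]\<close>. Since \<open>I - P\<close> is self-adjoint in \<open>L\<^sup>2(\<pi>)\<close>, pairing \<open>w\<close> with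
\<open>y \<mapsto> h\<^bsub>y,S\<^esub>(x)\<close> gives \<open>h\<^sub>S(x) = \<pi>(x) (1 + P w(x)) = \<pi>(x) E\<^sub>x[T\<^sub>S\<^sup>+]\<close>, so it suffices to bound \<open>max w\<close>.
Let \<open>\<gamma>\<close> be a Poincare constant. As \<open>w = 0\<close> on \<open>S\<close>, \<open>\<gamma> \<pi>(S) \<pi>(w)\<^sup>2 \<le> \<gamma> Var(w) \<le> \<langle>w, (I - P) w\<rangle> = \<pi>(w)\<close>,
hence \<open>\<pi>(w) \<le> 1 / (\<gamma> \<pi>(S))\<close>; and of order \<open>log(1/\<pi>\<^sub>m\<^sub>i\<^sub>n)/\<gamma>\<close> steps of the lazy chain flatten \<open>w\<close> to its mean.
This bounds \<open>h\<^sub>S(x)\<close> without the factor \<open>1/u(P) \<ge> 1\<close>.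

For the second inequality, \<open>g(z) = Pr\<^sub>z[T\<^sub>y < T\<^sub>x]\<close> has Dirichlet form \<open>\<pi>(x) Pr\<^sub>x[T\<^sub>y < T\<^sub>x\<^sup>+]\<close> and, taking the
values 0 and 1, variance at least \<open>\<pi>\<^sub>m\<^sub>i\<^sub>n/2\<close>; so \<open>u(P) \<ge> \<gamma> \<pi>\<^sub>m\<^sub>i\<^sub>n / (2 \<pi>\<^sub>m\<^sub>a\<^sub>x)\<close>.

Only the Poincare inequality for \<open>P\<close> itself is used, with no control of eigenvalues near \<open>-1\<close>. For a
periodic walk the inequality for the lazy chain, whose Dirichlet form is half as large, therefore suffices.
\<close>

section \<open>Reversible chains\<close>

lemma mpow_nonneg:
  assumes "stochastic n P" "x < n" "y < n"
  shows "mpow n P t x y \<ge> 0"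
  using assms(2,3)
  by (induction t arbitrary: x)
     (use assms(1) in \<open>auto simp: stochastic_def intro!: sum_nonneg mult_nonneg_nonneg\<close>)

locale reversible_chain =
  fixes n :: nat and P :: "nat \<Rightarrow> nat \<Rightarrow> real" and \<pi> :: "nat \<Rightarrow> real"
  assumes stoch: "stochastic n P" and rev: "reversible n P \<pi>"
    and pi_pos: "\<And>x. x < n \<Longrightarrow> \<pi> x > 0" and pi_sum: "(\<Sum>x<n. \<pi> x) = 1"
begin

definition step :: "(nat \<Rightarrow> real) \<Rightarrow> nat \<Rightarrow> real" where
  "step f x = (\<Sum>y<n. P x y * f y)"

definition ip :: "(nat \<Rightarrow> real) \<Rightarrow> (nat \<Rightarrow> real) \<Rightarrow> real" where
  "ip f g = (\<Sum>x<n. \<pi> x * f x * g x)"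

definition mean :: "(nat \<Rightarrow> real) \<Rightarrow> real" where
  "mean f = (\<Sum>x<n. \<pi> x * f x)"

lemma P_nonneg: "x < n \<Longrightarrow> y < n \<Longrightarrow> P x y \<ge> 0"
  and P_sum: "x < n \<Longrightarrow> (\<Sum>y<n. P x y) = 1"
  using stoch by (auto simp: stochastic_def)

lemma detailed_balance: "x < n \<Longrightarrow> y < n \<Longrightarrow> \<pi> x * P x y = \<pi> y * P y x"
  using rev by (auto simp: reversible_def)

lemma n_pos: "n > 0"
  using pi_sum by (cases n) auto

section \<open>Linear algebra in L2(\<pi>)\<close>

lemma ip_cong:
  "(\<And>x. x < n \<Longrightarrow> f x = f' x) \<Longrightarrow> (\<And>x. x < n \<Longrightarrow> g x = g' x) \<Longrightarrow> ip f g = ip f' g'"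
  unfolding ip_def by (intro sum.cong) auto

lemma step_cong: "(\<And>y. y < n \<Longrightarrow> f y = g y) \<Longrightarrow> step f x = step g x"
  unfolding step_def by (intro sum.cong) auto

lemma mean_cong: "(\<And>y. y < n \<Longrightarrow> f y = g y) \<Longrightarrow> mean f = mean g"
  unfolding mean_def by (intro sum.cong) auto

lemma ip_commute: "ip f g = ip g f"
  unfolding ip_def by (intro sum.cong) auto

lemma ip_add_right: "ip f (\<lambda>x. g x + h x) = ip f g + ip f h"
  and ip_add_left: "ip (\<lambda>x. g x + h x) f = ip g f + ip h f"
  and ip_diff_right: "ip f (\<lambda>x. g x - h x) = ip f g - ip f h"
  and ip_diff_left: "ip (\<lambda>x. g x - h x) f = ip g f - ip h f"
  and ip_scale_right: "ip f (\<lambda>x. c * g x) = c * ip f g"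
  and ip_scale_left: "ip (\<lambda>x. c * g x) f = c * ip g f"
  and ip_const_right: "ip f (\<lambda>x. c) = c * mean f"
  unfolding ip_def mean_def
  by (simp_all add: sum.distrib[symmetric] sum_subtractf[symmetric] sum_distrib_left algebra_simps)

lemma ip_const_left: "ip (\<lambda>x. c) f = c * mean f"
  using ip_const_right ip_commute by metis

lemmas ip_linear = ip_add_right ip_add_left ip_diff_right ip_diff_left
  ip_scale_right ip_scale_left ip_const_right ip_const_left

lemma mean_add: "mean (\<lambda>x. g x + h x) = mean g + mean h"
  and mean_diff: "mean (\<lambda>x. g x - h x) = mean g - mean h"
  and mean_scale: "mean (\<lambda>x. c * g x) = c * mean g"
  unfolding mean_def by (simp_all add: sum.distrib sum_subtractf sum_distrib_left algebra_simps)

lemma mean_const: "mean (\<lambda>x. c) = c"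
  unfolding mean_def by (simp add: sum_distrib_right[symmetric] pi_sum)

lemma step_add: "step (\<lambda>x. g x + h x) = (\<lambda>x. step g x + step h x)"
  and step_diff: "step (\<lambda>x. g x - h x) = (\<lambda>x. step g x - step h x)"
  and step_scale: "step (\<lambda>x. c * g x) = (\<lambda>x. c * step g x)"
  unfolding step_def
  by (simp_all add: sum.distrib sum_subtractf sum_distrib_left algebra_simps)

lemma step_const: "x < n \<Longrightarrow> step (\<lambda>x. c) x = c"
  unfolding step_def by (simp add: sum_distrib_right[symmetric] P_sum)

lemma step_mono: "x < n \<Longrightarrow> (\<And>y. y < n \<Longrightarrow> f y \<le> g y) \<Longrightarrow> step f x \<le> step g x"
  unfolding step_def by (intro sum_mono mult_left_mono) (auto intro: P_nonneg)

lemma step_nonneg: "x < n \<Longrightarrow> (\<And>y. y < n \<Longrightarrow> f y \<ge> 0) \<Longrightarrow> step f x \<ge> 0"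
  using step_mono[of x "\<lambda>_. 0" f] by (simp add: step_const)

lemma step_le: "x < n \<Longrightarrow> (\<And>y. y < n \<Longrightarrow> f y \<le> c) \<Longrightarrow> step f x \<le> c"
  using step_mono[of x f "\<lambda>_. c"] by (simp add: step_const)

text \<open>Detailed balance moves the kernel from one argument to the other once the two sums are
  exchanged.\<close>

lemma ip_step: "ip f (step g) = ip (step f) g"
proof -
  have "ip f (step g) = (\<Sum>x<n. \<Sum>y<n. (\<pi> x * P x y) * f x * g y)"
    unfolding ip_def step_def sum_distrib_left by (intro sum.cong) auto
  also have "\<dots> = (\<Sum>x<n. \<Sum>y<n. (\<pi> y * P y x) * f x * g y)"
    by (intro sum.cong refl) (simp add: detailed_balance)
  also have "\<dots> = (\<Sum>y<n. \<Sum>x<n. (\<pi> y * P y x) * f x * g y)"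
    by (rule sum.swap)
  also have "\<dots> = ip (step f) g"
    unfolding ip_def step_def sum_distrib_left sum_distrib_right by (intro sum.cong) auto
  finally show ?thesis .
qed

lemma mean_step: "mean (step f) = mean f"
proof -
  have "mean (step f) = ip (\<lambda>_. 1) (step f)" by (simp add: ip_const_left)
  also have "\<dots> = ip (step (\<lambda>_. 1)) f" by (rule ip_step)
  also have "\<dots> = ip (\<lambda>_. 1) f" by (rule ip_cong) (auto simp: step_const)
  finally show ?thesis by (simp add: ip_const_left)
qed

lemma ip_nonneg: "ip f f \<ge> 0"
  unfolding ip_def using pi_pos by (intro sum_nonneg) (auto simp: mult.assoc less_imp_le)

lemma ip_self_ge: "x < n \<Longrightarrow> \<pi> x * (f x)\<^sup>2 \<le> ip f f"
  unfolding ip_def using pi_pos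
  by (subst power2_eq_square, subst mult.assoc[symmetric],
      intro member_le_sum[of x "{..<n}" "\<lambda>x. \<pi> x * f x * f x"])
     (auto simp: mult.assoc less_imp_le)

lemma ip_self_eq_0D: "ip f f = 0 \<Longrightarrow> x < n \<Longrightarrow> f x = 0"
  using ip_self_ge[of x f] pi_pos[of x]
  by (metis antisym_conv mult_eq_0_iff mult_nonneg_nonneg less_imp_le zero_le_power2 zero_eq_power2 less_irrefl)

text \<open>Jensen's inequality: a row of \<open>P\<close> is a probability vector, and the variance
  of \<open>f\<close> under it is nonnegative.\<close>

lemma step_square_le: "x < n \<Longrightarrow> (step f x)\<^sup>2 \<le> step (\<lambda>y. (f y)\<^sup>2) x"
proof -
  assume x: "x < n"
  define m where "m = step f x"
  have "0 \<le> step (\<lambda>y. (f y - m)\<^sup>2) x" using x by (intro step_nonneg) auto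
  also have "step (\<lambda>y. (f y - m)\<^sup>2) x = step (\<lambda>y. ((f y)\<^sup>2 - (2*m) * f y) + m\<^sup>2) x"
    by (intro step_cong) (simp add: power2_eq_square algebra_simps)
  also have "\<dots> = step (\<lambda>y. (f y)\<^sup>2) x - 2 * m * m + m\<^sup>2"
    unfolding step_add step_diff step_scale using x by (simp add: step_const m_def)
  finally show ?thesis by (simp add: power2_eq_square m_def)
qed

text \<open>Jensen pointwise, then stationarity of \<open>\<pi>\<close>.\<close>

lemma ip_step_step_le: "ip (step f) (step f) \<le> ip f f"
proof -
  have "ip (step f) (step f) = mean (\<lambda>x. (step f x)\<^sup>2)"
    unfolding ip_def mean_def by (simp add: power2_eq_square mult.assoc)
  also have "\<dots> \<le> mean (step (\<lambda>y. (f y)\<^sup>2))"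
    unfolding mean_def by (intro sum_mono mult_left_mono step_square_le) (auto simp: pi_pos less_imp_le)
  also have "\<dots> = ip f f"
    unfolding mean_step by (simp add: ip_def mean_def power2_eq_square mult.assoc)
  finally show ?thesis .
qed

lemma variance_eq: "ip (\<lambda>x. f x - mean f) (\<lambda>x. f x - mean f) = ip f f - (mean f)\<^sup>2"
  by (simp add: ip_linear mean_diff mean_const power2_eq_square algebra_simps)

lemma pi_le_1: "x < n \<Longrightarrow> \<pi> x \<le> 1"
  using member_le_sum[of x "{..<n}" \<pi>] pi_sum pi_pos by (auto simp: less_imp_le)

section \<open>Dirichlet form and Rayleigh quotients\<close>

definition form :: "(nat \<Rightarrow> real) \<Rightarrow> real" where
  "form f = ip f f - ip f (step f)"

text \<open>Compactness replaces the spectral theorem: the quadratic form of \<open>step\<close> is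
  continuous, so it attains its maximum on the unit sphere of mean-zero functions.\<close>

lemma exists_maximizer:
  assumes "n \<ge> 2"
  obtains f where "ip f f = 1" "mean f = 0"
    "\<And>g. mean g = 0 \<Longrightarrow> ip g (step g) \<le> ip f (step f) * ip g g"
proof -
  \<comment> \<open>A function of unit norm satisfies \<open>\<pi> i * (f i)^2 \<le> 1\<close>, so
    the box contains the whole sphere. Coordinates from \<open>n\<close> on are pinned to 0, and
    Tychonoff gives compactness.\<close>
  define C where "C = PiE UNIV (\<lambda>i. if i < n then {- (1 / sqrt (\<pi> i)) .. 1 / sqrt (\<pi> i)} else {0::real})"
  have "compactin (product_topology (\<lambda>i. euclidean) UNIV) C"
    unfolding C_def by (subst compactin_PiE) auto
  then have C: "compact C"
    by (simp add: euclidean_product_topology)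
  have cont_ip: "continuous_on UNIV (\<lambda>f. ip f f)" "continuous_on UNIV mean"
    "continuous_on UNIV (\<lambda>f. ip f (step f))"
    unfolding ip_def mean_def step_def by (intro continuous_intros continuous_on_product_coordinates)+
  define K where "K = C \<inter> ({f. ip f f = 1} \<inter> {f. mean f = 0})"
  have "compact K" unfolding K_def
    using cont_ip by (intro compact_Int_closed C closed_Int closed_Collect_eq) auto
  have norm_in: "(\<lambda>i. if i < n then g i / sqrt (ip g g) else 0) \<in> K" (is "?h \<in> K")
    if "mean g = 0" "ip g g > 0" for g
  proof -
    have "ip ?h ?h = ip (\<lambda>i. (1 / sqrt (ip g g)) * g i) (\<lambda>i. (1 / sqrt (ip g g)) * g i)"
      by (intro ip_cong) auto
    also have "\<dots> = (1 / sqrt (ip g g)) * ((1 / sqrt (ip g g)) * ip g g)"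
      unfolding ip_linear by simp
    finally have 1: "ip ?h ?h = 1" using that by simp
    have "mean ?h = mean (\<lambda>i. (1 / sqrt (ip g g)) * g i)" by (intro mean_cong) auto
    then have 2: "mean ?h = 0" unfolding mean_scale using that by simp
    have "\<bar>?h i\<bar> \<le> 1 / sqrt (\<pi> i)" if "i < n" for i
    proof -
      have "(?h i)\<^sup>2 \<le> 1 / \<pi> i"
        using ip_self_ge[of i ?h] pi_pos[of i] that 1 by (simp only: field_simps)
      then have "sqrt ((?h i)\<^sup>2) \<le> sqrt (1 / \<pi> i)" using real_sqrt_le_mono by blast
      then show ?thesis by (simp add: real_sqrt_divide)
    qed
    then have "?h \<in> C" unfolding C_def by (fastforce simp: abs_le_iff)
    with 1 2 show ?thesis by (simp add: K_def)
  qed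
  \<comment> \<open>A nonzero mean-zero function supported on two states, which shows that the
    sphere \<open>K\<close> is nonempty.\<close>
  define g0 where "g0 = (\<lambda>i::nat. if i = 0 then \<pi> 1 else if i = 1 then - \<pi> 0 else 0)"
  have sub: "{0,1} \<subseteq> {..<n}" using assms by auto
  have "mean g0 = (\<Sum>x\<in>{0,1}. \<pi> x * g0 x)"
    unfolding mean_def by (rule sum.mono_neutral_right) (use sub in \<open>auto simp: g0_def\<close>)
  then have g01: "mean g0 = 0" by (simp add: g0_def)
  have "ip g0 g0 \<ge> \<pi> 0 * (g0 0)\<^sup>2" by (rule ip_self_ge) (use assms in auto)
  moreover have "\<pi> 0 * (g0 0)\<^sup>2 > 0" using assms pi_pos[of 0] pi_pos[of 1] by (simp add: g0_def)
  ultimately have "ip g0 g0 > 0" by linarith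
  with g01 norm_in have "K \<noteq> {}" by blast
  then obtain f where f: "f \<in> K" "\<And>g. g \<in> K \<Longrightarrow> ip g (step g) \<le> ip f (step f)"
    using continuous_attains_sup[OF \<open>compact K\<close>, of "\<lambda>f. ip f (step f)"]
      continuous_on_subset[OF cont_ip(3)] by auto
  show ?thesis
  proof
    show "ip f f = 1" "mean f = 0" using f by (auto simp: K_def)
    fix g assume g: "mean g = 0"
    show "ip g (step g) \<le> ip f (step f) * ip g g"
    proof (cases "ip g g = 0")
      case True
      then have "ip g (step g) = ip (\<lambda>_. 0) (step g)"
        using ip_self_eq_0D by (intro ip_cong) auto
      with True show ?thesis by (simp add: ip_const_left)
    next
      case False
      with ip_nonneg[of g] have pos: "ip g g > 0" by linarith
      let ?c = "1 / sqrt (ip g g)"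
      let ?h = "\<lambda>i. if i < n then g i / sqrt (ip g g) else 0"
      have "ip ?h (step ?h) = ip (\<lambda>i. ?c * g i) (step (\<lambda>i. ?c * g i))"
        by (intro ip_cong step_cong) auto
      also have "\<dots> = ip g (step g) / ip g g"
        unfolding step_scale ip_linear using pos by simp
      finally have "ip g (step g) / ip g g \<le> ip f (step f)"
        using f(2)[OF norm_in[OF g pos]] by simp
      then show ?thesis using pos by (simp add: divide_le_eq)
    qed
  qed
qed

text \<open>First-order optimality: moving the maximizer against its residual
  \<open>m f - P f\<close> would increase the Rayleigh quotient unless the residual
  vanishes.\<close>

lemma exists_extremal_eigenvector:
  assumes "n \<ge> 2"
  obtains f m where "ip f f = 1" "mean f = 0" "\<And>x. x < n \<Longrightarrow> step f x = m * f x"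
    "\<And>g. mean g = 0 \<Longrightarrow> ip g (step g) \<le> m * ip g g"
proof -
  obtain f where f: "ip f f = 1" "mean f = 0"
    "\<And>g. mean g = 0 \<Longrightarrow> ip g (step g) \<le> ip f (step f) * ip g g"
    using exists_maximizer[OF assms] by metis
  define m where "m = ip f (step f)"
  define g where "g = (\<lambda>x. m * f x - step f x)"
  have mg: "mean g = 0" unfolding g_def by (simp add: mean_diff mean_scale mean_step f)
  define q where "q = m * ip g g - ip g (step g)"
  have gg: "ip g g = m * ip f g - ip (step f) g"
    unfolding g_def[symmetric] by (subst (1) g_def) (simp add: ip_linear)
  \<comment> \<open>The form \<open>m * ip h h - ip h (step h)\<close> is nonnegative on mean-zero
    \<open>h\<close> and zero at \<open>f\<close>; this is its expansion at
    \<open>f - e g\<close>.\<close>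
  have key: "2 * e * ip g g \<le> e\<^sup>2 * q" for e
  proof -
    have "mean (\<lambda>x. f x - e * g x) = 0" by (simp add: mean_diff mean_scale f mg)
    from f(3)[OF this] have "ip (\<lambda>x. f x - e * g x) (step (\<lambda>x. f x - e * g x))
      \<le> m * ip (\<lambda>x. f x - e * g x) (\<lambda>x. f x - e * g x)" by (simp add: m_def)
    then have "ip f (step f) - e * ip f (step g) - e * (ip g (step f) - e * ip g (step g))
       \<le> m * (ip f f - e * ip f g - e * (ip g f - e * ip g g))"
      unfolding step_diff step_scale ip_linear by (simp add: algebra_simps)
    moreover have "ip f (step g) = m * ip f g - ip g g" "ip g (step f) = m * ip f g - ip g g"
      using gg ip_step[of f g] ip_commute[of g "step f"] by linarith+
    ultimately show ?thesis
      using f(1) ip_commute[of g f]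
      by (simp add: m_def[symmetric] q_def power2_eq_square algebra_simps)
  qed
  have "ip g g = 0"
  proof (rule ccontr)
    assume "ip g g \<noteq> 0"
    with ip_nonneg[of g] have pos: "ip g g > 0" by linarith
    \<comment> \<open>\<open>e = 1\<close> gives \<open>q > 0\<close>; then the optimal choice
      \<open>e = ip g g / q\<close> is contradictory.\<close>
    have q: "q \<ge> 2 * ip g g" using key[of 1] by simp
    then have "2 * (ip g g / q) * ip g g \<le> (ip g g / q)\<^sup>2 * q" using key by blast
    then show False using pos q by (simp add: power2_eq_square field_simps)
  qed
  then have "step f x = m * f x" if "x < n" for x
    using ip_self_eq_0D[of g x] that by (simp add: g_def)
  then show ?thesis using that f m_def by blast
qed

section \<open>Iterates of the kernel and the maximum principle\<close>

lemma mpow_sum: "x < n \<Longrightarrow> (\<Sum>y<n. mpow n P t x y) = 1"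
proof (induction t arbitrary: x)
  case (Suc t)
  have "(\<Sum>y<n. mpow n P (Suc t) x y) = (\<Sum>z<n. \<Sum>y<n. P x z * mpow n P t z y)"
    unfolding mpow.simps by (rule sum.swap)
  also have "\<dots> = (\<Sum>z<n. P x z)"
    by (intro sum.cong refl) (simp add: sum_distrib_left[symmetric] Suc.IH)
  finally show ?case using P_sum Suc by simp
qed auto

lemma mpow_eigenfunction:
  assumes "\<And>x. x < n \<Longrightarrow> step f x = m * f x" "x < n"
  shows "(\<Sum>y<n. mpow n P t x y * f y) = m ^ t * f x"
  using \<open>x < n\<close>
proof (induction t arbitrary: x)
  case 0
  have "(\<Sum>y<n. mpow n P 0 x y * f y) = (\<Sum>y<n. if x = y then f y else 0)"
    by (intro sum.cong) auto
  also have "\<dots> = f x" using 0 by simp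
  finally show ?case by simp
next
  case (Suc t)
  have "(\<Sum>y<n. mpow n P (Suc t) x y * f y) = (\<Sum>y<n. \<Sum>z<n. P x z * mpow n P t z y * f y)"
    by (simp add: sum_distrib_right)
  also have "\<dots> = (\<Sum>z<n. \<Sum>y<n. P x z * mpow n P t z y * f y)"
    by (rule sum.swap)
  also have "\<dots> = (\<Sum>z<n. P x z * (\<Sum>y<n. mpow n P t z y * f y))"
    by (simp add: sum_distrib_left mult.assoc)
  also have "\<dots> = (\<Sum>z<n. m ^ t * (P x z * f z))"
    by (intro sum.cong refl) (simp add: Suc.IH)
  also have "\<dots> = m ^ t * step f x"
    by (simp add: step_def sum_distrib_left)
  finally show ?case using assms(1) Suc.prems by simp
qed

text \<open>Compare the norms of \<open>m f\<close> and \<open>f\<close>: \<open>step\<close> is an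
  L2(\<pi>) contraction.\<close>

lemma eigenvalue_abs_le_1:
  assumes "\<And>x. x < n \<Longrightarrow> step f x = m * f x" "x0 < n" "f x0 \<noteq> 0"
  shows "\<bar>m\<bar> \<le> 1"
proof -
  have "ip f f > 0" using ip_nonneg[of f] ip_self_eq_0D[of f] assms(2,3)
    by (metis order_le_less)
  moreover have "ip (step f) (step f) = m * (m * ip f f)"
  proof -
    have "ip (step f) (step f) = ip (\<lambda>x. m * f x) (\<lambda>x. m * f x)"
      by (intro ip_cong assms)
    then show ?thesis unfolding ip_linear .
  qed
  ultimately have "m\<^sup>2 \<le> 1" using ip_step_step_le[of f] by (simp add: power2_eq_square mult.assoc[symmetric])
  then show ?thesis by (simp add: abs_square_le_1)
qed

lemma exists_max_abs:
  obtains x where "x < n" "\<And>y. y < n \<Longrightarrow> \<bar>f y\<bar> \<le> \<bar>f x :: real\<bar>"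
proof -
  have "Max ((\<lambda>x. \<bar>f x\<bar>) ` {..<n}) \<in> (\<lambda>x. \<bar>f x\<bar>) ` {..<n}"
    using n_pos by (intro Max_in) auto
  then obtain x where x: "x < n" "\<bar>f x\<bar> = Max ((\<lambda>x. \<bar>f x\<bar>) ` {..<n})" by auto
  show ?thesis by (rule that[OF x(1)]) (simp add: x(2))
qed

text \<open>Propagation step of the maximum principle, applied below to the deviation of a function
  from an extreme value.\<close>

lemma mpow_weighted_zero:
  assumes "x < n" "y < n" "\<And>z. z < n \<Longrightarrow> d z \<ge> 0" "(\<Sum>z<n. mpow n P t x z * d z) = 0"
    "mpow n P t x y > 0"
  shows "d y = 0"
proof -
  have "mpow n P t x y * d y \<le> (\<Sum>z<n. mpow n P t x z * d z)"
    using assms mpow_nonneg[OF stoch] by (intro member_le_sum[of y "{..<n}" "\<lambda>z. mpow n P t x z * d z"]) auto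
  then have "mpow n P t x y * d y \<le> 0" using assms by simp
  then show ?thesis using assms by (metis mult_le_0_iff order_antisym not_le)
qed

text \<open>If every return time were even, 2 would divide their gcd.\<close>

lemma aperiodic_odd_return:
  assumes "aperiodic_chain n P" "x < n"
  obtains t where "odd t" "mpow n P t x x > 0"
proof -
  have "\<exists>t. odd t \<and> mpow n P t x x > 0"
  proof (rule ccontr)
    assume "\<nexists>t. odd t \<and> mpow n P t x x > 0"
    then have "2 dvd Gcd {t. t \<ge> 1 \<and> mpow n P t x x > 0}"
      by (intro Gcd_greatest) auto
    then show False using assms by (simp add: aperiodic_chain_def)
  qed
  then show ?thesis using that by blast
qed

text \<open>For eigenvalue -1, averaging over an odd number of steps from a point of maximal modulus
  gives the opposite of its value, so every point reached has that opposite value. A return at an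
  odd time makes the value its own opposite.\<close>

lemma eigenvalue_neq_minus_1:
  assumes ap: "aperiodic_chain n P"
    and f: "\<And>x. x < n \<Longrightarrow> step f x = m * f x" "x0 < n" "f x0 \<noteq> 0"
  shows "m \<noteq> -1"
proof
  assume m: "m = -1"
  obtain x where x: "x < n" "\<And>y. y < n \<Longrightarrow> \<bar>f y\<bar> \<le> \<bar>f x\<bar>"
    using exists_max_abs[of f] by blast
  \<comment> \<open>The sign makes \<open>g x\<close> the modulus of \<open>f x\<close>, so that
    \<open>- g x\<close> is a lower bound for \<open>g\<close>.\<close>
  define g where "g = (\<lambda>y. sgn (f x) * f y)"
  have fx: "f x \<noteq> 0" using x(2)[OF f(2)] f(3) by auto
  have gx: "g x > 0" using fx by (auto simp: g_def sgn_if)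
  have gy: "g x + g y \<ge> 0" if "y < n" for y
    using x(2)[OF that] by (auto simp: g_def sgn_if)
  obtain t where t: "odd t" "mpow n P t x x > 0" using aperiodic_odd_return ap x by blast
  have "step g y = m * g y" if "y < n" for y
    unfolding g_def step_scale using f that by simp
  then have "(\<Sum>y<n. mpow n P t x y * g y) = m ^ t * g x" by (rule mpow_eigenfunction[OF _ x(1)])
  also have "\<dots> = - g x" using m t by simp
  finally have "(\<Sum>z<n. mpow n P t x z * (g x + g z)) = 0"
    using mpow_sum[OF x(1), of t] by (simp add: distrib_left sum.distrib sum_distrib_right[symmetric])
  from mpow_weighted_zero[OF x(1) x(1) gy this t(2)] gx show False by simp
qed

text \<open>Maximum principle: the maximum propagates to every state reachable from a maximizer, and
  irreducibility reaches all of them.\<close>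

lemma harmonic_const:
  assumes irr: "irreducible_chain n P"
    and f: "\<And>x. x < n \<Longrightarrow> step f x = f x" and "a < n" "b < n"
  shows "f a = f b"
proof -
  have "Max (f ` {..<n}) \<in> f ` {..<n}" using n_pos by (intro Max_in) auto
  then obtain x where x: "x < n" "f x = Max (f ` {..<n})" by auto
  have le: "f x - f y \<ge> 0" if "y < n" for y using that x by simp
  have "f x - f y = 0" if y: "y < n" for y
  proof -
    obtain t where t: "mpow n P t x y > 0" using irr x y by (auto simp: irreducible_chain_def)
    have "(\<Sum>z<n. mpow n P t x z * f z) = 1 ^ t * f x"
      by (rule mpow_eigenfunction[OF _ x(1)]) (simp add: f)
    then have "(\<Sum>z<n. mpow n P t x z * (f x - f z)) = 0"
      using mpow_sum[OF x(1), of t]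
      by (simp add: right_diff_distrib sum_subtractf sum_distrib_right[symmetric])
    from mpow_weighted_zero[OF x(1) y le this t] show ?thesis by simp
  qed
  from this[of a] this[of b] assms show ?thesis by simp
qed

end

section \<open>Eigenvalues and the Poincare inequality\<close>

lemma tmat_carrier: "tmat n P \<in> carrier_mat n n"
  by (simp add: tmat_def)

text \<open>Translates matrix spectra into functions on states, the language of
  \<open>step\<close>.\<close>

lemma eigenvalue_tmat_iff:
  "eigenvalue (tmat n P) m \<longleftrightarrow>
    (\<exists>f. (\<exists>x<n. f x \<noteq> 0) \<and> (\<forall>x<n. (\<Sum>y<n. P x y * f y) = m * f x))"
proof
  assume "eigenvalue (tmat n P) m"
  then obtain v where v: "v \<in> carrier_vec n" "v \<noteq> 0\<^sub>v n" "tmat n P *\<^sub>v v = m \<cdot>\<^sub>v v"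
    by (auto simp: eigenvalue_def eigenvector_def tmat_def)
  have "\<exists>x<n. v $ x \<noteq> 0"
  proof (rule ccontr)
    assume "\<not> (\<exists>x<n. v $ x \<noteq> 0)"
    then have "v = 0\<^sub>v n" using v(1) by (intro eq_vecI) auto
    with v show False by simp
  qed
  moreover have "(\<Sum>y<n. P x y * v $ y) = m * v $ x" if x: "x < n" for x
  proof -
    have "(tmat n P *\<^sub>v v) $ x = (\<Sum>y<n. P x y * v $ y)"
      using x v(1) by (simp add: tmat_def scalar_prod_def lessThan_atLeast0)
    moreover have "(m \<cdot>\<^sub>v v) $ x = m * v $ x" using x v(1) by simp
    ultimately show ?thesis using v(3) by simp
  qed
  ultimately show "\<exists>f. (\<exists>x<n. f x \<noteq> 0) \<and> (\<forall>x<n. (\<Sum>y<n. P x y * f y) = m * f x)"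
    by (intro exI[of _ "\<lambda>i. v $ i"]) auto
next
  assume "\<exists>f. (\<exists>x<n. f x \<noteq> 0) \<and> (\<forall>x<n. (\<Sum>y<n. P x y * f y) = m * f x)"
  then obtain f where f: "\<exists>x<n. f x \<noteq> 0" "\<forall>x<n. (\<Sum>y<n. P x y * f y) = m * f x" by blast
  let ?v = "vec n f"
  have "?v \<noteq> 0\<^sub>v n"
  proof
    assume eq: "?v = 0\<^sub>v n"
    obtain x where "x < n" "f x \<noteq> 0" using f by blast
    then show False using arg_cong[OF eq, of "\<lambda>v. v $ x"] by simp
  qed
  moreover have "tmat n P *\<^sub>v ?v = m \<cdot>\<^sub>v ?v"
    by (intro eq_vecI) (use f in \<open>auto simp: tmat_def scalar_prod_def lessThan_atLeast0\<close>)
  ultimately show "eigenvalue (tmat n P) m"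
    unfolding eigenvalue_def eigenvector_def by (intro exI[of _ ?v]) (auto simp: tmat_def)
qed

text \<open>Eigenvalues are roots of a monic, hence nonzero, polynomial. Finiteness makes the
  maximum in \<open>slem\<close> an attained one.\<close>

lemma finite_eigenvalues:
  assumes "A \<in> carrier_mat n n" shows "finite {m :: 'a :: field. eigenvalue A m}"
proof -
  have "char_poly A \<noteq> 0" using degree_monic_char_poly[OF assms] by (metis leading_coeff_0_iff zero_neq_one)
  from poly_roots_finite[OF this] show ?thesis
    using eigenvalue_root_char_poly[OF assms] by simp
qed

text \<open>Conjugation by the unipotent matrix whose first column is the all-ones vector splits off the
  trivial eigenvalue of a matrix with unit row sums.\<close>

lemma char_poly_unit_row_sums:
  fixes P :: "nat \<Rightarrow> nat \<Rightarrow> real"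
  assumes "\<And>x. x < Suc k \<Longrightarrow> (\<Sum>y<Suc k. P x y) = 1"
  shows "char_poly (tmat (Suc k) P)
    = [:-1, 1:] * char_poly (mat k k (\<lambda>(i, j). P (Suc i) (Suc j) - P 0 (Suc j)))"
proof -
  define A where "A = tmat (Suc k) P"
  define B where "B = mat k k (\<lambda>(i, j). P (Suc i) (Suc j) - P 0 (Suc j))"
  define A1 where "A1 = mat 1 1 (\<lambda>_. 1 :: real)"
  define A2 where "A2 = mat 1 k (\<lambda>(i, j). P 0 (Suc j))"
  \<comment> \<open>\<open>A\<close> fixes the all-ones vector, so after the change of basis its
    first column is a unit vector, and \<open>B\<close> is the action on functions modulo
    constants.\<close>
  define D where "D = four_block_mat A1 A2 (0\<^sub>m k 1) B"
  define T where "T = mat (Suc k) (Suc k) (\<lambda>(i, j). if j = 0 \<or> i = j then 1 else 0 :: real)"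
  define T' where "T' = mat (Suc k) (Suc k) (\<lambda>(i, j). if i = j then 1 else if j = 0 then -1 else 0 :: real)"
  have A: "A \<in> carrier_mat (Suc k) (Suc k)" by (simp add: A_def tmat_def)
  have D: "D \<in> carrier_mat (Suc k) (Suc k)" by (auto simp: D_def A1_def B_def)
  have D_eq: "D = mat (Suc k) (Suc k) (\<lambda>(i, j).
      if j = 0 then if i = 0 then 1 else 0 else if i = 0 then P 0 j else P i j - P 0 j)"
    by (intro eq_matI) (auto simp: D_def A1_def A2_def B_def)
  have T: "T \<in> carrier_mat (Suc k) (Suc k)" "T' \<in> carrier_mat (Suc k) (Suc k)"
    by (auto simp: T_def T'_def)
  have sum_T: "(\<Sum>l<Suc k. (if l = 0 \<or> i = l then 1 else 0) * h l) = (if i = 0 then h 0 else h 0 + h i)"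
    if "i < Suc k" for i and h :: "nat \<Rightarrow> real"
  proof -
    have "(\<Sum>l<Suc k. (if l = 0 \<or> i = l then 1 else 0) * h l) = (\<Sum>l\<in>{0,i}. h l)"
      by (rule sum.mono_neutral_cong_right) (use that in auto)
    then show ?thesis by auto
  qed
  have row_T: "(T * M) $$ (i, j) = (if i = 0 then M $$ (0, j) else M $$ (0, j) + M $$ (i, j))"
    if "i < Suc k" "j < Suc k" "M \<in> carrier_mat (Suc k) (Suc k)" for M i j
  proof -
    have "(T * M) $$ (i, j) = (\<Sum>l<Suc k. (if l = 0 \<or> i = l then 1 else 0) * M $$ (l, j))"
      unfolding T_def using that
      by (auto simp: scalar_prod_def lessThan_atLeast0 intro!: sum.cong)
    then show ?thesis using sum_T[OF that(1), of "\<lambda>l. M $$ (l, j)"] by simp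
  qed
  have col_T: "(A * T) $$ (i, j) = (if j = 0 then 1 else P i j)" if "i < Suc k" "j < Suc k" for i j
  proof -
    have "(A * T) $$ (i, j) = (\<Sum>l<Suc k. P i l * (if j = 0 \<or> l = j then 1 else 0))"
      unfolding T_def A_def tmat_def using that
      by (auto simp: scalar_prod_def lessThan_atLeast0 intro!: sum.cong)
    also have "\<dots> = (\<Sum>l<Suc k. if j = 0 then P i l else if l = j then P i l else 0)"
      by (intro sum.cong) auto
    also have "\<dots> = (if j = 0 then 1 else P i j)"
      using assms[OF that(1)] that(2) by (simp del: sum.lessThan_Suc)
    finally show ?thesis .
  qed
  have AT: "A * T = T * D"
  proof (rule eq_matI)
    fix i j assume "i < dim_row (T * D)" "j < dim_col (T * D)"
    then have ij: "i < Suc k" "j < Suc k" using T D by auto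
    then show "(A * T) $$ (i, j) = (T * D) $$ (i, j)"
      unfolding col_T[OF ij] row_T[OF ij D] by (auto simp: D_eq)
  qed (use A T D in auto)
  have TT': "T * T' = 1\<^sub>m (Suc k)"
  proof (rule eq_matI)
    fix i j assume "i < dim_row (1\<^sub>m (Suc k))" "j < dim_col (1\<^sub>m (Suc k))"
    then have ij: "i < Suc k" "j < Suc k" by auto
    then show "(T * T') $$ (i, j) = 1\<^sub>m (Suc k) $$ (i, j)"
      unfolding row_T[OF ij T(2)] by (auto simp: T'_def)
  qed (use T in auto)
  have T'T: "T' * T = 1\<^sub>m (Suc k)"
    using mat_mult_left_right_inverse[OF T TT'] .
  have "A = A * (T * T')" using A TT' by simp
  also have "\<dots> = (A * T) * T'" using assoc_mult_mat[OF A T] by simp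
  finally have "A = T * D * T'" using AT by simp
  then have "similar_mat A D"
    using A D T TT' T'T by (intro similar_matI[of _ _ T T' "Suc k"]) auto
  then have "char_poly A = char_poly D" by (rule char_poly_similar)
  also have "\<dots> = char_poly A1 * char_poly B"
    unfolding D_def by (rule char_poly_four_block_zeros_col) (auto simp: A1_def A2_def B_def)
  also have "char_poly A1 = [:-1, 1:]"
    by (simp add: A1_def char_poly_defs det_single)
  finally show ?thesis unfolding A_def B_def .
qed

context reversible_chain begin

text \<open>A generalised eigenvector \<open>f\<close> for the eigenvalue 1 satisfies \<open>step f - f = const\<close>; since
  \<open>step\<close> preserves the \<open>\<pi>\<close>-mean, the constant vanishes and \<open>f\<close> is harmonic.\<close>

lemma order_one_char_poly:
  assumes irr: "irreducible_chain n P"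
  shows "order 1 (char_poly (tmat n P)) \<le> 1"
proof -
  obtain k where k: "n = Suc k" using n_pos by (cases n) auto
  define B where "B = mat k k (\<lambda>(i, j). P (Suc i) (Suc j) - P 0 (Suc j))"
  have B: "B \<in> carrier_mat k k" by (simp add: B_def)
  have cp: "char_poly (tmat n P) = [:-1, 1:] * char_poly B"
    unfolding k B_def by (rule char_poly_unit_row_sums) (use P_sum k in auto)
  have B_tmat: "B = tmat k (\<lambda>i j. P (Suc i) (Suc j) - P 0 (Suc j))" by (simp add: B_def tmat_def)
  have "\<not> eigenvalue B 1"
  proof
    assume "eigenvalue B 1"
    then obtain v where v: "\<exists>i<k. v i \<noteq> 0"
      "\<forall>i<k. (\<Sum>j<k. (P (Suc i) (Suc j) - P 0 (Suc j)) * v j) = v i"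
      unfolding B_tmat eigenvalue_tmat_iff by auto
    \<comment> \<open>\<open>B\<close> acts on functions modulo constants; \<open>f\<close> is the
      representative vanishing at state 0, and \<open>step f 0\<close> is the constant by which it
      could fail to be harmonic.\<close>
    define f where "f = (\<lambda>x. case x of 0 \<Rightarrow> 0 | Suc i \<Rightarrow> v i)"
    have st: "step f x = (\<Sum>j<k. P x (Suc j) * v j)" for x
      unfolding step_def by (simp add: k f_def sum.lessThan_Suc_shift del: sum.lessThan_Suc)
    have 1: "step f x = f x + step f 0" if "x < n" for x
    proof (cases x)
      case (Suc i)
      then show ?thesis using v(2) that k unfolding st
        by (simp add: f_def left_diff_distrib sum_subtractf algebra_simps)
    qed (simp add: f_def)
    have "mean f = mean (\<lambda>x. f x + step f 0)"
      using mean_step[of f] mean_cong[OF 1] by simp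
    then have "step f 0 = 0" by (simp add: mean_add mean_const)
    then have "step f x = f x" if "x < n" for x using 1[OF that] by simp
    then have const: "f a = f 0" if "a < n" for a using harmonic_const[OF irr] that n_pos by blast
    obtain i where "i < k" "v i \<noteq> 0" using v by blast
    then show False using const[of "Suc i"] by (simp add: f_def k)
  qed
  then have nr: "poly (char_poly B) 1 \<noteq> 0" using eigenvalue_root_char_poly[OF B] by blast
  then have "order 1 (char_poly B) = 0" by (rule order_0I)
  moreover have "char_poly B \<noteq> 0" using nr by auto
  then have "[:-1, 1::real:] * char_poly B \<noteq> 0" by (simp del: mult_pCons_left)
  moreover have "order 1 [:-1, 1::real:] \<le> degree [:-1, 1::real:]" by (rule order_degree) simp
  ultimately show ?thesis unfolding cp by (simp add: order_mult del: mult_pCons_left)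
qed

text \<open>The extremal eigenvalue \<open>m\<close> differs from 1 by the maximum principle, so
  \<open>\<bar>m\<bar>\<close> competes in \<open>slem\<close>; the Rayleigh bound for
  \<open>m\<close>, applied to \<open>f - mean f\<close>, gives the inequality. \<open>slem\<close>
  is itself the modulus of an eigenvalue other than 1 and -1.\<close>

lemma slem_poincare:
  assumes n: "n \<ge> 2" and irr: "irreducible_chain n P" and ap: "aperiodic_chain n P"
  shows "0 \<le> slem n P" "slem n P < 1"
    "(1 - slem n P) * (ip f f - (mean f)\<^sup>2) \<le> form f"
proof -
  define E where "E = {\<bar>m\<bar> | m. eigenvalue (tmat n P) m \<and>
                     (m \<noteq> 1 \<or> order 1 (char_poly (tmat n P)) \<ge> 2)}"
  \<comment> \<open>Simplicity of the root 1 reduces the set to the moduli of the eigenvalues other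
    than 1.\<close>
  have E: "E = abs ` {m. eigenvalue (tmat n P) m \<and> m \<noteq> 1}"
    using order_one_char_poly[OF irr] by (auto simp: E_def)
  have finE: "finite E" unfolding E
    by (intro finite_imageI finite_subset[OF _ finite_eigenvalues[OF tmat_carrier[of n P]]]) auto
  obtain g m where g: "ip g g = 1" "mean g = 0" "\<And>x. x < n \<Longrightarrow> step g x = m * g x"
    "\<And>h. mean h = 0 \<Longrightarrow> ip h (step h) \<le> m * ip h h"
    using exists_extremal_eigenvector[OF n] by blast
  have g_nz: "\<exists>x<n. g x \<noteq> 0"
  proof (rule ccontr)
    assume "\<not> (\<exists>x<n. g x \<noteq> 0)"
    then have "ip g g = ip (\<lambda>_. 0) (\<lambda>_. 0)" by (intro ip_cong) auto
    with g show False by (simp add: ip_const_left)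
  qed
  have "m \<noteq> 1"
  proof
    assume "m = 1"
    then have "step g x = g x" if "x < n" for x using g that by simp
    then have c: "g a = g 0" if "a < n" for a using harmonic_const[OF irr] that n_pos by blast
    then have "mean g = mean (\<lambda>_. g 0)" by (intro mean_cong)
    then have "g 0 = 0" using g by (simp add: mean_const)
    with c g_nz show False by auto
  qed
  moreover have "eigenvalue (tmat n P) m"
    unfolding eigenvalue_tmat_iff using g g_nz unfolding step_def by blast
  ultimately have mE: "\<bar>m\<bar> \<in> E" unfolding E by blast
  have slem: "slem n P = Max E" by (simp add: slem_def E_def)
  have m_le: "\<bar>m\<bar> \<le> slem n P" unfolding slem using finE mE by simp
  then show "0 \<le> slem n P" by linarith
  have "slem n P \<in> E" unfolding slem using finE mE by (intro Max_in) auto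
  then obtain l where l: "slem n P = \<bar>l\<bar>" "eigenvalue (tmat n P) l" "l \<noteq> 1" unfolding E by auto
  obtain h x where h: "x < n" "h x \<noteq> 0" "\<And>x. x < n \<Longrightarrow> step h x = l * h x"
    using l(2) unfolding eigenvalue_tmat_iff step_def by blast
  have "\<bar>l\<bar> \<le> 1" using eigenvalue_abs_le_1[OF h(3) h(1,2)] .
  moreover have "l \<noteq> -1" using eigenvalue_neq_minus_1[OF ap h(3) h(1,2)] .
  ultimately show "slem n P < 1" using l by linarith
  let ?c = "\<lambda>x. f x - mean f"
  have "mean ?c = 0" by (simp add: mean_diff mean_const)
  then have "ip ?c (step ?c) \<le> m * ip ?c ?c" by (rule g(4))
  also have "\<dots> \<le> slem n P * ip ?c ?c"
    using m_le by (intro mult_right_mono ip_nonneg) auto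
  finally have "(1 - slem n P) * ip ?c ?c \<le> ip ?c ?c - ip ?c (step ?c)" by (simp add: algebra_simps)
  moreover have "ip ?c (step ?c) = ip ?c (\<lambda>x. step f x - mean f)"
    by (intro ip_cong) (simp_all add: step_diff step_const)
  moreover have "\<dots> = ip f (step f) - (mean f)\<^sup>2"
    by (simp add: ip_linear mean_diff mean_const mean_step power2_eq_square)
  ultimately show "(1 - slem n P) * (ip f f - (mean f)\<^sup>2) \<le> form f"
    by (simp add: variance_eq form_def)
qed

end

section \<open>Hitting times\<close>

text \<open>\<open>\<gamma>\<close> is abstract so that one argument serves both
  \<open>1 - slem n P\<close> and, for periodic walks, the gap of the lazy chain; harmonic measure
  and escape probabilities remain those of \<open>P\<close>.\<close>

locale poincare_chain = reversible_chain +
  fixes \<gamma> :: real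
  assumes gap_pos: "0 < \<gamma>" and gap_le_1: "\<gamma> \<le> 1"
    and poincare: "\<And>f. \<gamma> * (ip f f - (mean f)\<^sup>2) \<le> form f"
begin

section \<open>Contraction of the lazy kernel\<close>

definition half_step :: "(nat \<Rightarrow> real) \<Rightarrow> nat \<Rightarrow> real" where
  "half_step f = (\<lambda>x. (1/2) * (f x + step f x))"

lemma half_step_cong: "(\<And>y. y < n \<Longrightarrow> f y = g y) \<Longrightarrow> x < n \<Longrightarrow> half_step f x = half_step g x"
  unfolding half_step_def using step_cong[of f g x] by simp

lemma mean_half_step: "mean (half_step f) = mean f"
  unfolding half_step_def mean_scale mean_add mean_step by simp

text \<open>Expand the square: the norm of \<open>step f\<close> is at most that of
  \<open>f\<close>, and the Poincare inequality bounds the cross terms, giving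
  \<open>(1 + 2 * (1 - \<gamma>) + 1) / 4 = 1 - \<gamma>/2\<close>.\<close>

lemma half_step_contraction:
  assumes "mean f = 0"
  shows "ip (half_step f) (half_step f) \<le> (1 - \<gamma>/2) * ip f f"
proof -
  have "ip (half_step f) (half_step f)
      = (ip f f + ip f (step f) + (ip (step f) f + ip (step f) (step f))) / 4"
    unfolding half_step_def ip_linear by (simp add: add_divide_distrib)
  moreover have "\<gamma> * ip f f \<le> ip f f - ip f (step f)"
    using poincare[of f] assms by (simp add: form_def)
  ultimately show ?thesis
    using ip_step_step_le[of f] ip_commute[of f "step f"] by (simp add: algebra_simps)
qed

lemma mean_half_step_iter: "mean ((half_step ^^ t) f) = mean f"
  by (induction t) (auto simp: mean_half_step)

lemma half_step_iter_contraction: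
  assumes "mean f = 0"
  shows "ip ((half_step ^^ t) f) ((half_step ^^ t) f) \<le> (1 - \<gamma>/2) ^ t * ip f f"
proof (induction t)
  case (Suc t)
  have "ip ((half_step ^^ Suc t) f) ((half_step ^^ Suc t) f)
      \<le> (1 - \<gamma>/2) * ip ((half_step ^^ t) f) ((half_step ^^ t) f)"
    using half_step_contraction[of "(half_step ^^ t) f"] mean_half_step_iter[of t f] assms by simp
  also have "\<dots> \<le> (1 - \<gamma>/2) * ((1 - \<gamma>/2) ^ t * ip f f)"
    using Suc gap_le_1 by (intro mult_left_mono) auto
  finally show ?case by simp
qed simp

lemma half_step_iter_shift:
  "x < n \<Longrightarrow> (half_step ^^ t) (\<lambda>x. f x - c) x = (half_step ^^ t) f x - c"
proof (induction t arbitrary: x)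
  case (Suc t)
  have "(half_step ^^ Suc t) (\<lambda>x. f x - c) x = half_step (\<lambda>x. (half_step ^^ t) f x - c) x"
    using half_step_cong[OF Suc.IH] Suc.prems by simp
  also have "\<dots> = (half_step ^^ Suc t) f x - c"
    using Suc.prems by (simp add: half_step_def step_diff step_const)
  finally show ?case .
qed simp

text \<open>A lazy step moves with probability 1/2 and so costs half a unit of time; monotonicity of
  the kernel allows iteration.\<close>

lemma subsolution_iter:
  assumes sub: "\<And>x. x < n \<Longrightarrow> w x \<le> 1 + step w x" and "x < n"
  shows "w x \<le> (half_step ^^ t) w x + t / 2"
  using \<open>x < n\<close>
proof (induction t arbitrary: x)
  case (Suc t)
  define u where "u = (half_step ^^ t) w"
  have IH: "w y \<le> u y + t / 2" if "y < n" for y using Suc.IH[OF that] by (simp add: u_def)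
  have "step w x \<le> step (\<lambda>x. u x + t / 2) x"
    by (intro step_mono IH Suc.prems)
  then have "step w x \<le> step u x + t / 2"
    using Suc.prems by (simp add: step_add step_const)
  then have "half_step w x \<le> half_step u x + t / 2"
    using IH[OF Suc.prems] unfolding half_step_def by (simp add: field_simps)
  moreover have "w x \<le> half_step w x + 1 / 2"
    using sub[OF Suc.prems] by (simp add: half_step_def field_simps)
  ultimately have "w x \<le> half_step u x + Suc t / 2" by (simp add: field_simps)
  then show ?case by (simp add: u_def)
qed simp

section \<open>Hitting times through subsolutions\<close>

lemma pimin_le: "x < n \<Longrightarrow> pimin n \<pi> \<le> \<pi> x"
  and le_pimax: "x < n \<Longrightarrow> \<pi> x \<le> pimax n \<pi>"
  by (auto simp: pimin_def pimax_def)

lemma pimin_pos: "pimin n \<pi> > 0"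
proof -
  have "pimin n \<pi> \<in> \<pi> ` {..<n}" unfolding pimin_def using n_pos by (intro Min_in) auto
  then show ?thesis using pi_pos by auto
qed

lemma pimin_le_1: "pimin n \<pi> \<le> 1"
  using pimin_le[of 0] pi_le_1[of 0] n_pos by simp

lemma ip_eq_sum_squares: "ip f f = (\<Sum>x<n. \<pi> x * (f x)\<^sup>2)"
  unfolding ip_def by (simp add: power2_eq_square mult.assoc)

text \<open>Stated for subsolutions, so that it covers truncated hitting times before their limit is
  known to be finite.\<close>

lemma subsolution_mean_le:
  assumes S: "S \<subseteq> {..<n}" "S \<noteq> {}"
    and w: "\<And>x. x < n \<Longrightarrow> w x \<ge> 0" "\<And>x. x \<in> S \<Longrightarrow> w x = 0" "\<And>x. x < n \<Longrightarrow> w x \<le> 1 + step w x"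
  shows "mean w \<le> 1 / (\<gamma> * sum \<pi> S)"
proof -
  have finS: "finite S" using S finite_subset by blast
  have piS: "sum \<pi> S > 0" using S finS pi_pos by (intro sum_pos) auto
  define m where "m = mean w"
  have "form w = (\<Sum>x<n. \<pi> x * (w x * (w x - step w x)))"
    by (simp add: form_def ip_def sum_subtractf[symmetric] algebra_simps)
  also have "\<dots> \<le> (\<Sum>x<n. \<pi> x * (w x * 1))"
    using w pi_pos by (intro sum_mono mult_left_mono) (auto simp: less_imp_le algebra_simps)
  also have "\<dots> = m" by (simp add: m_def mean_def)
  finally have 1: "form w \<le> m" .
  have "sum \<pi> S * m\<^sup>2 = (\<Sum>x\<in>S. \<pi> x * (w x - m)\<^sup>2)"
    using w by (simp add: sum_distrib_right)
  also have "\<dots> \<le> ip (\<lambda>x. w x - m) (\<lambda>x. w x - m)"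
    unfolding ip_eq_sum_squares using S pi_pos
    by (intro sum_mono2) (auto simp: less_imp_le)
  finally have "sum \<pi> S * m\<^sup>2 \<le> ip w w - (mean w)\<^sup>2" using variance_eq[of w] by (simp add: m_def)
  \<comment> \<open>Quadratic in \<open>m\<close> on the left, linear on the right: cancelling one
    \<open>m\<close> gives the bound.\<close>
  then have "\<gamma> * (sum \<pi> S * m\<^sup>2) \<le> m"
    using 1 poincare[of w] gap_pos by (meson mult_left_mono less_imp_le order_trans)
  moreover have "m \<ge> 0" unfolding m_def mean_def
    using w pi_pos by (intro sum_nonneg mult_nonneg_nonneg) (auto simp: less_imp_le)
  ultimately have "m * (\<gamma> * sum \<pi> S) \<le> 1"
    by (cases "m = 0") (auto simp: power2_eq_square algebra_simps)
  then show ?thesis using piS gap_pos by (simp add: m_def field_simps)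
qed

text \<open>Iterating the lazy kernel brings \<open>w\<close> within \<open>max w / 2\<close> of its mean, so that \<open>max w\<close> can be
  absorbed.\<close>

lemma subsolution_le:
  assumes S: "S \<subseteq> {..<n}" "S \<noteq> {}"
    and w: "\<And>x. x < n \<Longrightarrow> w x \<ge> 0" "\<And>x. x \<in> S \<Longrightarrow> w x = 0" "\<And>x. x < n \<Longrightarrow> w x \<le> 1 + step w x"
    and "x < n"
  shows "w x \<le> 2 / \<gamma> * ln (4 / pimin n \<pi>) + 1 + 2 / (\<gamma> * sum \<pi> S)"
proof -
  define M where "M = Max (w ` {..<n})"
  have "M \<in> w ` {..<n}" unfolding M_def using n_pos by (intro Max_in) auto
  then obtain y where y: "y < n" "M = w y" by auto
  have wM: "w z \<le> M" if "z < n" for z using that by (simp add: M_def)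
  have M0: "M \<ge> 0" using y w by simp
  define L where "L = ln (4 / pimin n \<pi>)"
  have L: "L \<ge> 0" using pimin_pos pimin_le_1 by (simp add: L_def)
  \<comment> \<open>Chosen so that
    \<open>(1 - \<gamma>/2)^t \<le> exp (- L) = pimin n \<pi> / 4\<close>.\<close>
  define t where "t = nat \<lceil>2 / \<gamma> * L\<rceil>"
  have "2 / \<gamma> * L \<ge> 0" using L gap_pos by simp
  then have t: "2 / \<gamma> * L \<le> t" "t \<le> 2 / \<gamma> * L + 1" unfolding t_def by linarith+
  have rho: "(1 - \<gamma>/2) ^ t \<le> pimin n \<pi> / 4"
  proof -
    have "(1 - \<gamma>/2) ^ t \<le> exp (- \<gamma>/2) ^ t"
      using exp_ge_add_one_self[of "-\<gamma>/2"] gap_le_1 by (intro power_mono) auto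
    also have "\<dots> = exp (- (\<gamma>/2 * t))" by (simp add: exp_of_nat_mult[symmetric] mult.commute)
    also have "\<dots> \<le> exp (- L)" using t(1) gap_pos by (simp add: field_simps)
    also have "\<dots> = pimin n \<pi> / 4" using pimin_pos by (simp add: L_def exp_minus)
    finally show ?thesis .
  qed
  define v where "v = (\<lambda>x. w x - mean w)"
  have v0: "mean v = 0" by (simp add: v_def mean_diff mean_const)
  have "ip v v \<le> ip w w" using variance_eq[of w] by (simp add: v_def)
  also have "\<dots> \<le> (\<Sum>x<n. \<pi> x * M\<^sup>2)"
    unfolding ip_eq_sum_squares using w wM pi_pos
    by (intro sum_mono mult_left_mono power_mono) (auto simp: less_imp_le)
  also have "\<dots> = M\<^sup>2" by (simp add: sum_distrib_right[symmetric] pi_sum)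
  finally have vM: "ip v v \<le> M\<^sup>2" .
  \<comment> \<open>Passing from L2(\<pi>) to a single point costs \<open>1 / pimin n \<pi>\<close>,
    which the decay absorbs; the remaining 1/4 becomes 1/2 after a square root.\<close>
  have "pimin n \<pi> * ((half_step ^^ t) v y)\<^sup>2 \<le> \<pi> y * ((half_step ^^ t) v y)\<^sup>2"
    using pimin_le y by (intro mult_right_mono) auto
  also have "\<dots> \<le> ip ((half_step ^^ t) v) ((half_step ^^ t) v)"
    by (rule ip_self_ge[OF y(1)])
  also have "\<dots> \<le> (1 - \<gamma>/2) ^ t * ip v v" by (rule half_step_iter_contraction[OF v0])
  also have "\<dots> \<le> pimin n \<pi> / 4 * M\<^sup>2"
    using rho vM pimin_pos ip_nonneg by (intro mult_mono) auto
  finally have "pimin n \<pi> * ((half_step ^^ t) v y)\<^sup>2 \<le> pimin n \<pi> * (M / 2)\<^sup>2"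
    by (simp add: power2_eq_square)
  then have "((half_step ^^ t) v y)\<^sup>2 \<le> (M / 2)\<^sup>2" using pimin_pos by simp
  then have "(half_step ^^ t) v y \<le> M / 2" by (rule power2_le_imp_le) (use M0 in simp)
  then have "(half_step ^^ t) w y \<le> mean w + M / 2"
    using half_step_iter_shift[OF y(1), of t w "mean w"] by (simp add: v_def)
  moreover have "M \<le> (half_step ^^ t) w y + t / 2"
    using subsolution_iter[OF w(3) y(1)] y(2) by simp
  ultimately have "M \<le> t + 2 * mean w" by (simp add: field_simps)
  also have "\<dots> \<le> 2 / \<gamma> * L + 1 + 2 * (1 / (\<gamma> * sum \<pi> S))"
    using t subsolution_mean_le[OF S w] by (intro add_mono mult_left_mono) auto
  finally show ?thesis using wM[OF \<open>x < n\<close>] by (simp add: L_def)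
qed

text \<open>This is \<open>E\<^sub>x[min(T\<^sub>S, t)]\<close>, built by first-step
  analysis.\<close>

primrec truncated_hitting_time :: "nat set \<Rightarrow> nat \<Rightarrow> nat \<Rightarrow> real" where
  "truncated_hitting_time S 0 = (\<lambda>x. 0)"
| "truncated_hitting_time S (Suc t) =
    (\<lambda>x. if x \<in> S then 0 else 1 + step (truncated_hitting_time S t) x)"

lemma truncated_hitting_time_nonneg: "x < n \<Longrightarrow> truncated_hitting_time S t x \<ge> 0"
  by (induction t arbitrary: x) (auto intro!: add_nonneg_nonneg step_nonneg)

lemma truncated_hitting_time_mono:
  "x < n \<Longrightarrow> truncated_hitting_time S t x \<le> truncated_hitting_time S (Suc t) x"
proof (induction t arbitrary: x)
  case 0
  then show ?case using truncated_hitting_time_nonneg[OF 0, of S "Suc 0"] by simp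
next
  case (Suc t)
  have "step (truncated_hitting_time S t) x \<le> step (truncated_hitting_time S (Suc t)) x"
    by (intro step_mono Suc)
  then show ?case by simp
qed

text \<open>Truncated hitting times increase with \<open>t\<close>, and
  \<open>subsolution_le\<close> bounds them uniformly. Their limit is therefore finite and inherits
  both the bound and the first-step equation off \<open>S\<close>.\<close>

lemma exists_hitting_time:
  assumes S: "S \<subseteq> {..<n}" "S \<noteq> {}"
  obtains w where "\<And>x. x < n \<Longrightarrow> w x \<ge> 0" "\<And>x. x \<in> S \<Longrightarrow> w x = 0"
    "\<And>x. x < n \<Longrightarrow> x \<notin> S \<Longrightarrow> w x = 1 + step w x"
    "\<And>x. x < n \<Longrightarrow> w x \<le> 2 / \<gamma> * ln (4 / pimin n \<pi>) + 1 + 2 / (\<gamma> * sum \<pi> S)"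
proof -
  define K where "K = 2 / \<gamma> * ln (4 / pimin n \<pi>) + 1 + 2 / (\<gamma> * sum \<pi> S)"
  define h where "h = truncated_hitting_time S"
  have h0: "h t x = 0" if "x \<in> S" for t x using that by (cases t) (auto simp: h_def)
  have hS: "h (Suc t) x = (if x \<in> S then 0 else 1 + step (h t) x)" for t x by (simp add: h_def)
  have nonneg: "h t x \<ge> 0" if "x < n" for t x
    using truncated_hitting_time_nonneg[OF that] by (simp add: h_def)
  have mono: "h t x \<le> h (Suc t) x" if "x < n" for t x
    using truncated_hitting_time_mono[OF that] unfolding h_def .
  \<comment> \<open>Monotonicity in \<open>t\<close> turns the recursion for
    \<open>h (Suc t)\<close> into a subsolution inequality for \<open>h t\<close> itself.\<close>
  have sub: "h t x \<le> 1 + step (h t) x" if "x < n" for t x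
  proof (cases "x \<in> S")
    case True
    have "step (h t) x \<ge> 0" using that nonneg by (intro step_nonneg)
    then show ?thesis using h0[OF True] by simp
  next
    case False
    then show ?thesis using mono[OF that, of t] hS[of t x] by simp
  qed
  have bound: "h t x \<le> K" if "x < n" for t x
    unfolding K_def by (rule subsolution_le[OF S nonneg h0 sub that])
  define w where "w = (\<lambda>x. lim (\<lambda>t. h t x))"
  have lim: "(\<lambda>t. h t x) \<longlonglongrightarrow> w x" if x: "x < n" for x
  proof -
    have "incseq (\<lambda>t. h t x)" using mono[OF x] by (intro incseq_SucI)
    then obtain l where "(\<lambda>t. h t x) \<longlonglongrightarrow> l"
      by (rule incseq_convergent[of _ K]) (use bound[OF x] in auto)
    then show ?thesis by (simp add: w_def limI)
  qed
  show ?thesis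
  proof
    show "w x \<ge> 0" if "x < n" for x
      by (rule LIMSEQ_le_const[OF lim[OF that]]) (use nonneg that in auto)
    show "w x \<le> 2 / \<gamma> * ln (4 / pimin n \<pi>) + 1 + 2 / (\<gamma> * sum \<pi> S)" if "x < n" for x
      unfolding K_def[symmetric] by (rule LIMSEQ_le_const2[OF lim[OF that]]) (use bound that in auto)
    show "w x = 0" if "x \<in> S" for x
      using h0[OF that] by (simp add: w_def limI)
    show "w x = 1 + step w x" if x: "x < n" "x \<notin> S" for x
    proof (rule LIMSEQ_unique)
      show "(\<lambda>t. h (Suc t) x) \<longlonglongrightarrow> w x" by (rule LIMSEQ_Suc[OF lim[OF x(1)]])
      have "(\<lambda>t. 1 + step (h t) x) \<longlonglongrightarrow> 1 + step w x"
        unfolding step_def by (intro tendsto_intros lim) auto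
      then show "(\<lambda>t. h (Suc t) x) \<longlonglongrightarrow> 1 + step w x" using x by (simp add: hS)
    qed
  qed
qed

end

section \<open>Harmonic measure and escape probabilities\<close>

context reversible_chain begin

section \<open>Hitting distributions as convergent series\<close>

lemma stay_nonneg: "v < n \<Longrightarrow> stay n P S t v x \<ge> 0"
  by (induction t arbitrary: v) (auto intro!: sum_nonneg mult_nonneg_nonneg P_nonneg)

text \<open>For \<open>x \<in> S\<close> the terms are the probabilities of the disjoint events
  \<open>T\<^sub>S = s, X\<^sub>s = x\<close>.\<close>

lemma stay_partial_sum_le_1:
  assumes "x \<in> S" "v < n"
  shows "(\<Sum>s<t. stay n P S s v x) \<le> 1"
  using \<open>v < n\<close>
proof (induction t arbitrary: v)
  case (Suc t)
  show ?case
  proof (cases "v \<in> S")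
    case False
    have "(\<Sum>s<Suc t. stay n P S s v x) = (\<Sum>s<t. \<Sum>u<n. P v u * stay n P S s u x)"
      unfolding sum.lessThan_Suc_shift using False assms by auto
    also have "\<dots> = (\<Sum>u<n. \<Sum>s<t. P v u * stay n P S s u x)"
      by (rule sum.swap)
    also have "\<dots> = step (\<lambda>u. \<Sum>s<t. stay n P S s u x) v"
      by (simp add: step_def sum_distrib_left)
    also have "\<dots> \<le> 1" by (intro step_le Suc)
    finally show ?thesis .
  qed (simp add: sum.lessThan_Suc_shift del: sum.lessThan_Suc)
qed simp

lemma stay_summable:
  assumes "x \<in> S" "v < n"
  shows "summable (\<lambda>t. stay n P S t v x)"
  by (rule summableI_nonneg_bounded[of _ 1])
     (use assms stay_nonneg stay_partial_sum_le_1 in auto)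

lemma harm_nonneg: "x \<in> S \<Longrightarrow> v < n \<Longrightarrow> harm n P v S x \<ge> 0"
  unfolding harm_def by (intro suminf_nonneg stay_summable stay_nonneg)

lemma harm_le_1: "x \<in> S \<Longrightarrow> v < n \<Longrightarrow> harm n P v S x \<le> 1"
  unfolding harm_def by (intro suminf_le_const stay_summable stay_partial_sum_le_1)

text \<open>This one exchange of sums gives first-step analysis both for \<open>harm\<close> and for
  \<open>escape_prob\<close>.\<close>

lemma suminf_step_stay:
  assumes "x \<in> S" "v < n"
  shows "(\<Sum>t. \<Sum>u<n. P v u * stay n P S t u x) = step (\<lambda>u. harm n P u S x) v"
proof -
  have "(\<Sum>t. \<Sum>u<n. P v u * stay n P S t u x) = (\<Sum>u<n. \<Sum>t. P v u * stay n P S t u x)"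
    by (rule suminf_sum) (use assms stay_summable in \<open>auto intro!: summable_mult\<close>)
  also have "\<dots> = (\<Sum>u<n. P v u * (\<Sum>t. stay n P S t u x))"
    by (intro sum.cong refl suminf_mult stay_summable assms) auto
  finally show ?thesis by (simp add: step_def harm_def)
qed

lemma harm_boundary:
  assumes "x \<in> S" "v < n" "v \<in> S"
  shows "harm n P v S x = (if v = x then 1 else 0)"
  using suminf_split_head[OF stay_summable[OF assms(1,2)]] assms by (simp add: harm_def)

lemma harm_harmonic:
  assumes "x \<in> S" "v < n" "v \<notin> S"
  shows "harm n P v S x = step (\<lambda>u. harm n P u S x) v"
proof -
  have "v \<noteq> x" using assms by auto
  then show ?thesis
    using suminf_split_head[OF stay_summable[OF assms(1,2)]] assms suminf_step_stay[OF assms(1,2)]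
    by (simp add: harm_def)
qed

text \<open>The unconditional first step accounts for the return time
  \<open>T\<^sub>x\<^sup>+\<close>; afterwards only the order of hitting \<open>x\<close> and
  \<open>y\<close> matters.\<close>

lemma escape_prob_eq:
  "x < n \<Longrightarrow> escape_prob n P x y = step (\<lambda>u. harm n P u {x, y} y) x"
  unfolding escape_prob_def by (rule suminf_step_stay) auto

lemma escape_prob_le_1: "x < n \<Longrightarrow> escape_prob n P x y \<le> 1"
  by (simp add: escape_prob_eq step_le harm_le_1)

text \<open>Kac's formula: pairing \<open>h = harm \<cdot> S x\<close> and \<open>w\<close> through the self-adjoint operator
  \<open>I - step\<close> kills every term of \<open>\<langle>(I - step) h, w\<rangle>\<close>.\<close>

lemma harm_stat_eq:
  assumes S: "S \<subseteq> {..<n}" and x: "x \<in> S"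
    and w: "\<And>y. y \<in> S \<Longrightarrow> w y = 0" "\<And>y. y < n \<Longrightarrow> y \<notin> S \<Longrightarrow> w y = 1 + step w y"
  shows "harm_stat n P \<pi> S x = \<pi> x * (1 + step w x)"
proof -
  have xn: "x < n" using S x by auto
  define h where "h = (\<lambda>y. harm n P y S x)"
  have hS: "h y = (if y = x then 1 else 0)" if "y \<in> S" for y
    using harm_boundary[OF x _ that] S that by (auto simp: h_def)
  have hH: "h y = step h y" if "y < n" "y \<notin> S" for y
    unfolding h_def by (rule harm_harmonic[OF x that])
  have "ip h (\<lambda>y. w y - step w y) = ip (\<lambda>y. h y - step h y) w"
    by (simp add: ip_linear ip_step)
  also have "\<dots> = ip (\<lambda>_. 0) (\<lambda>_. 0)"
    unfolding ip_def
  proof (intro sum.cong refl)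
    fix y assume "y \<in> {..<n}"
    then have "h y - step h y = 0 \<or> w y = 0" using hH[of y] w(1)[of y] by auto
    then show "\<pi> y * (h y - step h y) * w y = \<pi> y * 0 * 0" by auto
  qed
  also have "\<dots> = 0" by (simp add: ip_const_left)
  finally have "0 = ip h (\<lambda>y. w y - step w y)" by simp
  \<comment> \<open>Off \<open>S\<close>, \<open>w - step w\<close> is 1. On \<open>S\<close> only
    \<open>y = x\<close> contributes, with \<open>- step w x\<close>, written as
    \<open>1 - (1 + step w x)\<close>.\<close>
  also have "\<dots> = (\<Sum>y<n. \<pi> y * h y - (if y = x then \<pi> x * (1 + step w x) else 0))"
    unfolding ip_def
  proof (intro sum.cong refl)
    fix y assume "y \<in> {..<n}"
    then have y: "y < n" by simp
    show "\<pi> y * h y * (w y - step w y) = \<pi> y * h y - (if y = x then \<pi> x * (1 + step w x) else 0)"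
    proof (cases "y \<in> S")
      case True
      then show ?thesis using hS[OF True] w(1)[OF True] by (auto simp: algebra_simps)
    next
      case False
      then have "y \<noteq> x" using x by auto
      with w(2)[OF y False] show ?thesis by simp
    qed
  qed
  also have "\<dots> = (\<Sum>y<n. \<pi> y * h y) - \<pi> x * (1 + step w x)"
    using xn by (simp add: sum_subtractf)
  finally show ?thesis by (simp add: harm_stat_def h_def)
qed

text \<open>\<open>D = (I - P) g\<close> is supported on \<open>{x, y}\<close> and has mean zero, so
  its two masses cancel. The form sees the mass at \<open>y\<close>, where \<open>g = 1\<close>; the
  mass at \<open>x\<close> is minus \<open>\<pi> x\<close> times the escape probability.\<close>

lemma form_escape:
  assumes "x < n" "y < n" "x \<noteq> y"
  shows "form (\<lambda>u. harm n P u {x, y} y) = \<pi> x * escape_prob n P x y"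
proof -
  define g where "g = (\<lambda>u. harm n P u {x, y} y)"
  define D where "D = (\<lambda>u. g u - step g u)"
  have g: "g x = 0" "g y = 1"
    unfolding g_def using assms by (simp_all add: harm_boundary)
  have D0: "D u = 0" if "u < n" "u \<noteq> x" "u \<noteq> y" for u
    using harm_harmonic[of y "{x,y}" u] that by (simp add: D_def g_def)
  have two: "(\<Sum>u<n. \<pi> u * c u * D u) = \<pi> x * c x * D x + \<pi> y * c y * D y" for c
  proof -
    have "(\<Sum>u<n. \<pi> u * c u * D u) = (\<Sum>u\<in>{x,y}. \<pi> u * c u * D u)"
      by (rule sum.mono_neutral_right) (use assms D0 in auto)
    then show ?thesis using assms by simp
  qed
  have "mean D = 0" unfolding D_def by (simp add: mean_diff mean_step)
  then have "\<pi> x * D x + \<pi> y * D y = 0" using two[of "\<lambda>_. 1"] by (simp add: mean_def)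
  moreover have "form g = ip g D" by (simp add: form_def D_def ip_linear)
  moreover have "ip g D = \<pi> y * D y" unfolding ip_def two using g by simp
  moreover have "D x = - escape_prob n P x y"
    using g escape_prob_eq[OF assms(1), of y] by (simp add: D_def g_def)
  ultimately show ?thesis by (simp add: g_def)
qed

lemma finite_escape_probs: "finite {escape_prob n P x y | x y. x < n \<and> y < n \<and> x \<noteq> y}"
  by (rule finite_subset[of _ "(\<lambda>(x, y). escape_prob n P x y) ` ({..<n} \<times> {..<n})"]) auto

lemma uP_attained:
  assumes "n \<ge> 2"
  obtains x y where "x < n" "y < n" "x \<noteq> y" "uP n P = escape_prob n P x y"
proof -
  have "escape_prob n P 0 1 \<in> {escape_prob n P x y | x y. x < n \<and> y < n \<and> x \<noteq> y}"
    using assms by (intro CollectI exI[of _ 0] exI[of _ 1]) auto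
  then have "uP n P \<in> {escape_prob n P x y | x y. x < n \<and> y < n \<and> x \<noteq> y}"
    unfolding uP_def using finite_escape_probs by (intro Min_in) auto
  then show ?thesis using that by blast
qed

end

section \<open>Quantitative bounds on harmonic measure and escape\<close>

context poincare_chain begin

lemma harm_stat_le:
  assumes S: "S \<subseteq> {..<n}" "S \<noteq> {}" and x: "x \<in> S"
  shows "harm_stat n P \<pi> S x
    \<le> 6 / \<gamma> * \<pi> x * max (ln (2 * exp 1 / pimin n \<pi>)) (1 / sum \<pi> S)"
proof -
  have xn: "x < n" using S x by auto
  define L where "L = ln (2 * exp 1 / pimin n \<pi>)"
  define K where "K = 2 / \<gamma> * ln (4 / pimin n \<pi>) + 1 + 2 / (\<gamma> * sum \<pi> S)"
  obtain w where w: "\<And>y. y < n \<Longrightarrow> w y \<ge> 0" "\<And>y. y \<in> S \<Longrightarrow> w y = 0"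
    "\<And>y. y < n \<Longrightarrow> y \<notin> S \<Longrightarrow> w y = 1 + step w y" "\<And>y. y < n \<Longrightarrow> w y \<le> K"
    unfolding K_def using exists_hitting_time[OF S] by blast
  have "harm_stat n P \<pi> S x = \<pi> x * (1 + step w x)"
    by (rule harm_stat_eq[OF S(1) x w(2,3)])
  also have "\<dots> \<le> \<pi> x * (1 + K)"
    using pi_pos[OF xn] step_le[OF xn w(4)] by (intro mult_left_mono) auto
  \<comment> \<open>\<open>1 + K\<close> has three terms, each at most \<open>2 / \<gamma>\<close>
    times the maximum, whence the 6; for the constant term 2 this uses \<open>1 \<le> L\<close> and
    \<open>\<gamma> \<le> 1\<close>.\<close>
  also have "1 + K \<le> 6 / \<gamma> * max L (1 / sum \<pi> S)"
  proof -
    have "2 \<le> exp (1::real)" using exp_ge_add_one_self[of 1] by simp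
    then have "ln (4 / pimin n \<pi>) \<le> L"
      unfolding L_def using pimin_pos by (intro ln_mono divide_right_mono) auto
    moreover have "1 \<le> L"
    proof -
      have "exp 1 \<le> 2 * exp 1 / pimin n \<pi>"
        using pimin_pos pimin_le_1 by (simp add: le_divide_eq)
      then have "ln (exp 1) \<le> L" unfolding L_def using pimin_pos by (intro ln_mono) auto
      then show ?thesis by simp
    qed
    ultimately have "2 / \<gamma> * ln (4 / pimin n \<pi>) \<le> 2 / \<gamma> * max L (1 / sum \<pi> S)"
      using gap_pos by (intro mult_left_mono) auto
    moreover have "2 / \<gamma> * (1 / sum \<pi> S) \<le> 2 / \<gamma> * max L (1 / sum \<pi> S)"
      using gap_pos by (intro mult_left_mono) auto
    moreover have "2 * 1 \<le> 2 / \<gamma> * max L (1 / sum \<pi> S)"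
      using gap_pos gap_le_1 \<open>1 \<le> L\<close> by (intro mult_mono) (auto simp: le_divide_eq)
    ultimately show ?thesis by (simp add: K_def)
  qed
  finally show ?thesis using pi_pos[OF xn] by (simp add: L_def mult_ac)
qed

lemma escape_prob_ge:
  assumes "x < n" "y < n" "x \<noteq> y"
  shows "\<gamma> * pimin n \<pi> / (2 * pimax n \<pi>) \<le> escape_prob n P x y"
proof -
  define g where "g = (\<lambda>u. harm n P u {x, y} y)"
  define m where "m = mean g"
  have g: "g x = 0" "g y = 1"
    unfolding g_def using assms by (simp_all add: harm_boundary)
  have pmax: "pimax n \<pi> > 0" using le_pimax[OF assms(1)] pi_pos[OF assms(1)] by simp
  \<comment> \<open>The values 0 and 1 cannot both be close to the mean \<open>m\<close>; this is
    the 1/2 in the variance bound.\<close>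
  have "1 / 2 \<le> m\<^sup>2 + (1 - m)\<^sup>2"
    using zero_le_power2[of "2 * m - 1"] by (simp add: power2_eq_square algebra_simps)
  then have "pimin n \<pi> * (1 / 2) \<le> pimin n \<pi> * (m\<^sup>2 + (1 - m)\<^sup>2)"
    using pimin_pos by (intro mult_left_mono) auto
  also have "\<dots> = pimin n \<pi> * m\<^sup>2 + pimin n \<pi> * (1 - m)\<^sup>2" by (simp add: distrib_left)
  also have "\<dots> \<le> \<pi> x * m\<^sup>2 + \<pi> y * (1 - m)\<^sup>2"
    using assms by (intro add_mono mult_right_mono pimin_le) auto
  also have "\<dots> = (\<Sum>u\<in>{x,y}. \<pi> u * (g u - m)\<^sup>2)" using assms g by simp
  also have "\<dots> \<le> ip (\<lambda>u. g u - m) (\<lambda>u. g u - m)"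
    unfolding ip_eq_sum_squares using assms pi_pos
    by (intro sum_mono2) (auto simp: less_imp_le)
  finally have "\<gamma> * (pimin n \<pi> * (1 / 2)) \<le> \<gamma> * (ip g g - (mean g)\<^sup>2)"
    unfolding m_def variance_eq using gap_pos by (intro mult_left_mono) auto
  also have "\<dots> \<le> form g" by (rule poincare)
  also have "\<dots> = \<pi> x * escape_prob n P x y" unfolding g_def by (rule form_escape[OF assms])
  also have "\<dots> \<le> pimax n \<pi> * escape_prob n P x y"
    using le_pimax[OF assms(1)] assms
    by (intro mult_right_mono) (auto simp: escape_prob_eq intro!: step_nonneg harm_nonneg)
  finally show ?thesis using pmax by (simp add: field_simps)
qed

lemma uP_bounds:
  assumes "n \<ge> 2"
  shows "\<gamma> * pimin n \<pi> / (2 * pimax n \<pi>) \<le> uP n P" "0 < uP n P" "uP n P \<le> 1"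
proof -
  obtain x y where xy: "x < n" "y < n" "x \<noteq> y" "uP n P = escape_prob n P x y"
    using uP_attained[OF assms] by blast
  show *: "\<gamma> * pimin n \<pi> / (2 * pimax n \<pi>) \<le> uP n P" using escape_prob_ge[OF xy(1-3)] xy(4) by simp
  have "pimax n \<pi> > 0" using le_pimax[OF xy(1)] pi_pos[OF xy(1)] by simp
  then have "\<gamma> * pimin n \<pi> / (2 * pimax n \<pi>) > 0" using gap_pos pimin_pos by simp
  with * show "0 < uP n P" by linarith
  show "uP n P \<le> 1" using escape_prob_le_1[OF xy(1)] xy(4) by simp
qed

text \<open>The slack from 6 to 24 is the factor 4 that \<open>ln_two_exp_le\<close> costs on
  regular graphs, so one constant serves both settings; 48 doubles it because of the 2 in the lower
  bound on \<open>uP\<close>.\<close>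

lemma uP_inequalities:
  assumes "n \<ge> 2"
  shows "6 / \<gamma> \<le> 24 / (uP n P * \<gamma>)"
    "24 / (uP n P * \<gamma>) \<le> 48 * pimax n \<pi> / (\<gamma>\<^sup>2 * pimin n \<pi>)"
proof -
  note u = uP_bounds[OF assms]
  have "uP n P * 6 \<le> 24" using u by linarith
  then show "6 / \<gamma> \<le> 24 / (uP n P * \<gamma>)" using u gap_pos by (simp add: field_simps)
  have pmax: "pimax n \<pi> > 0" using le_pimax[of 0] pi_pos[of 0] n_pos by simp
  have "24 / (uP n P * \<gamma>) \<le> 24 / (\<gamma> * pimin n \<pi> / (2 * pimax n \<pi>) * \<gamma>)"
    using u gap_pos pimin_pos pmax
    by (intro divide_left_mono mult_right_mono mult_pos_pos) auto
  also have "\<dots> = 48 * pimax n \<pi> / (\<gamma>\<^sup>2 * pimin n \<pi>)"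
    by (simp add: power2_eq_square field_simps)
  finally show "24 / (uP n P * \<gamma>) \<le> 48 * pimax n \<pi> / (\<gamma>\<^sup>2 * pimin n \<pi>)" .
qed

end

section \<open>Lazy chains and random walks on regular graphs\<close>

lemma stationary_mpow:
  assumes st: "stochastic n P" and rv: "reversible n P \<pi>" and y: "y < n"
  shows "(\<Sum>x<n. \<pi> x * mpow n P t x y) = \<pi> y"
proof (induction t)
  case 0
  have "(\<Sum>x<n. \<pi> x * mpow n P 0 x y) = (\<Sum>x<n. if x = y then \<pi> x else 0)"
    by (intro sum.cong) auto
  then show ?case using y by simp
next
  case (Suc t)
  have "(\<Sum>x<n. \<pi> x * mpow n P (Suc t) x y) = (\<Sum>x<n. \<Sum>z<n. (\<pi> x * P x z) * mpow n P t z y)"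
    by (simp add: sum_distrib_left mult.assoc)
  also have "\<dots> = (\<Sum>x<n. \<Sum>z<n. (\<pi> z * P z x) * mpow n P t z y)"
    using rv by (intro sum.cong refl) (simp add: reversible_def)
  also have "\<dots> = (\<Sum>z<n. \<Sum>x<n. (\<pi> z * P z x) * mpow n P t z y)"
    by (rule sum.swap)
  also have "\<dots> = (\<Sum>z<n. \<pi> z * mpow n P t z y * (\<Sum>x<n. P z x))"
    unfolding sum_distrib_left by (intro sum.cong refl) simp
  also have "\<dots> = (\<Sum>z<n. \<pi> z * mpow n P t z y)"
    using st by (intro sum.cong refl) (simp add: stochastic_def)
  finally show ?case using Suc by simp
qed

text \<open>Some state has positive mass, and stationarity carries it along a path:
  \<open>\<pi> y \<ge> \<pi> x * mpow n P t x y\<close>.\<close>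

lemma reversible_chain_of_irreducible:
  assumes st: "stochastic n P" and irr: "irreducible_chain n P"
    and pr: "prob_on n \<pi>" and rv: "reversible n P \<pi>"
  shows "reversible_chain n P \<pi>"
proof
  show "stochastic n P" "reversible n P \<pi>" "(\<Sum>x<n. \<pi> x) = 1"
    using assms by (auto simp: prob_on_def)
  have nn: "\<pi> x \<ge> 0" if "x < n" for x using pr that by (auto simp: prob_on_def)
  fix y assume y: "y < n"
  have "\<exists>x<n. \<pi> x \<noteq> 0"
  proof (rule ccontr)
    assume "\<not> (\<exists>x<n. \<pi> x \<noteq> 0)"
    then have "(\<Sum>x<n. \<pi> x) = 0" by simp
    then show False using pr by (simp add: prob_on_def)
  qed
  then obtain x where x: "x < n" "\<pi> x > 0" using nn by (metis order_le_less)
  obtain t where t: "mpow n P t x y > 0" using irr x y by (auto simp: irreducible_chain_def)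
  have "0 < \<pi> x * mpow n P t x y" using x t by simp
  also have "\<dots> \<le> (\<Sum>x<n. \<pi> x * mpow n P t x y)"
    using x y nn mpow_nonneg[OF st]
    by (intro member_le_sum[of x "{..<n}" "\<lambda>x. \<pi> x * mpow n P t x y"]) auto
  also have "\<dots> = \<pi> y" by (rule stationary_mpow[OF st rv y])
  finally show "\<pi> y > 0" .
qed

lemma poincare_chain_slem:
  assumes "reversible_chain n P \<pi>" "n \<ge> 2" "irreducible_chain n P" "aperiodic_chain n P"
  shows "poincare_chain n P \<pi> (1 - slem n P)"
proof -
  interpret reversible_chain n P \<pi> by fact
  show ?thesis by unfold_locales (use slem_poincare[OF assms(2-4)] in auto)
qed

section \<open>Passage to the lazy chain\<close>

lemma lazy_stochastic: "stochastic n P \<Longrightarrow> stochastic n (lazy P)"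
  by (auto simp: stochastic_def lazy_def sum_divide_distrib[symmetric] sum.distrib)

lemma lazy_reversible: "reversible n P \<pi> \<Longrightarrow> reversible n (lazy P) \<pi>"
  by (auto simp: reversible_def lazy_def)

text \<open>With probability \<open>(1/2)^t\<close> the lazy chain follows \<open>P\<close> at each
  of its \<open>t\<close> steps.\<close>

lemma mpow_lazy_ge:
  assumes st: "stochastic n P" and "x < n" "y < n"
  shows "(1/2) ^ t * mpow n P t x y \<le> mpow n (lazy P) t x y"
  using assms(2)
proof (induction t arbitrary: x)
  case (Suc t)
  have "(1/2) ^ Suc t * mpow n P (Suc t) x y
      = (\<Sum>z<n. (P x z / 2) * ((1/2) ^ t * mpow n P t z y))"
    by (simp add: sum_distrib_left mult_ac)
  also have "\<dots> \<le> (\<Sum>z<n. lazy P x z * mpow n (lazy P) t z y)"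
  proof (rule sum_mono, rule mult_mono)
    fix z assume "z \<in> {..<n}"
    then have z: "z < n" by simp
    then have "P x z \<ge> 0" using st Suc.prems by (simp add: stochastic_def)
    then show "P x z / 2 \<le> lazy P x z" "0 \<le> lazy P x z" by (simp_all add: lazy_def)
    show "(1/2) ^ t * mpow n P t z y \<le> mpow n (lazy P) t z y" by (rule Suc.IH[OF z])
    show "0 \<le> (1/2) ^ t * mpow n P t z y" using mpow_nonneg[OF st z assms(3)] by simp
  qed
  finally show ?case by simp
qed simp

lemma lazy_irreducible:
  assumes st: "stochastic n P" and irr: "irreducible_chain n P"
  shows "irreducible_chain n (lazy P)"
  unfolding irreducible_chain_def
proof (intro allI impI)
  fix x y assume xy: "x < n" "y < n"
  then obtain t where "mpow n P t x y > 0" using irr by (auto simp: irreducible_chain_def)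
  then have "(1/2) ^ t * mpow n P t x y > 0" by simp
  also have "\<dots> \<le> mpow n (lazy P) t x y" by (rule mpow_lazy_ge[OF st xy])
  finally show "\<exists>t. mpow n (lazy P) t x y > 0" ..
qed

text \<open>Holding with probability at least 1/2 makes 1 a return time.\<close>

lemma lazy_aperiodic:
  assumes st: "stochastic n P"
  shows "aperiodic_chain n (lazy P)"
  unfolding aperiodic_chain_def
proof (intro allI impI)
  fix x assume x: "x < n"
  have "mpow n (lazy P) 1 x x = (\<Sum>z<n. if z = x then lazy P x x else 0)"
    unfolding One_nat_def mpow.simps by (intro sum.cong) auto
  also have "\<dots> > 0" using x st by (simp add: lazy_def stochastic_def add_nonneg_pos)
  finally have "1 \<in> {t. t \<ge> 1 \<and> mpow n (lazy P) t x x > 0}" by simp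
  then have "Gcd {t. t \<ge> 1 \<and> mpow n (lazy P) t x x > 0} dvd 1" by (rule Gcd_dvd)
  then show "Gcd {t. t \<ge> 1 \<and> mpow n (lazy P) t x x > 0} = 1" by simp
qed

lemma poincare_chain_slem_lazy:
  assumes rc: "reversible_chain n P \<pi>" and n: "n \<ge> 2" and irr: "irreducible_chain n P"
  shows "poincare_chain n P \<pi> (1 - slem n (lazy P))"
proof -
  interpret reversible_chain n P \<pi> by fact
  interpret L: reversible_chain n "lazy P" \<pi>
    by unfold_locales (auto simp: lazy_stochastic lazy_reversible stoch rev pi_pos pi_sum)
  note L = L.slem_poincare[OF n lazy_irreducible[OF stoch irr] lazy_aperiodic[OF stoch]]
  have "L.form f \<le> form f" for f
  proof -
    have "L.step f x = (1/2) * (f x + step f x)" if "x < n" for x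
    proof -
      have "L.step f x = (\<Sum>y<n. (1/2) * ((if y = x then f x else 0) + P x y * f y))"
        unfolding L.step_def lazy_def by (intro sum.cong) (auto simp: algebra_simps)
      also have "\<dots> = (1/2) * (f x + step f x)"
        unfolding sum_distrib_left[symmetric] sum.distrib using that by (simp add: step_def)
      finally show ?thesis .
    qed
    then have "ip f (L.step f) = ip f (\<lambda>x. (1/2) * (f x + step f x))" by (intro ip_cong) auto
    then have "L.form f = form f / 2"
      unfolding L.form_def form_def ip_linear by (simp add: field_simps)
    \<comment> \<open>Half of \<open>form f\<close> lies below \<open>form f\<close> once it is
      nonnegative, which the lazy Poincare inequality supplies.\<close>
    moreover have "0 \<le> L.form f"
    proof -
      have "0 \<le> (1 - slem n (lazy P)) * (ip f f - (mean f)\<^sup>2)"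
        using L(2) variance_eq[of f] ip_nonneg[of "\<lambda>x. f x - mean f"]
        by (intro mult_nonneg_nonneg) auto
      also have "\<dots> \<le> L.form f" by (rule L(3))
      finally show ?thesis .
    qed
    ultimately show ?thesis by linarith
  qed
  then have "(1 - slem n (lazy P)) * (ip f f - (mean f)\<^sup>2) \<le> form f" for f
    using L(3)[of f] order_trans by blast
  then show ?thesis by unfold_locales (use L(1,2) in auto)
qed

section \<open>Simple random walk on a connected graph\<close>

lemma connected_graph_degree_pos:
  assumes "n \<ge> 2" "connected_graph n E" "x < n"
  shows "card {z. z < n \<and> E x z} > 0"
proof -
  obtain y where y: "y < n" "y \<noteq> x"
    by (metis assms(1,3) One_nat_def Suc_1 Suc_le_eq less_trans zero_less_one zero_neq_one zero_less_Suc lessI)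
  have "(\<lambda>a b. a < n \<and> b < n \<and> E a b)\<^sup>*\<^sup>* x y" using assms y by (auto simp: connected_graph_def)
  \<comment> \<open>Since \<open>y \<noteq> x\<close>, the path starts with an edge at
    \<open>x\<close>.\<close>
  then obtain z where "z < n" "E x z" using y by (auto elim: converse_rtranclpE)
  then have "{z. z < n \<and> E x z} \<noteq> {}" by auto
  then show ?thesis by (simp add: card_gt_0_iff)
qed

lemma srw_stochastic:
  assumes "n \<ge> 2" "connected_graph n E"
  shows "stochastic n (srw n E)"
proof -
  have "(\<Sum>y<n. srw n E x y) = 1" if x: "x < n" for x
  proof -
    let ?N = "{z. z < n \<and> E x z}"
    have "(\<Sum>y<n. srw n E x y) = (\<Sum>y\<in>?N. 1 / real (card ?N))"
      unfolding srw_def by (rule sum.mono_neutral_cong_right) auto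
    also have "\<dots> = real (card ?N) * (1 / real (card ?N))" by (simp only: sum_constant)
    also have "\<dots> = 1"
      using right_inverse[of "real (card ?N)"] connected_graph_degree_pos[OF assms x]
      unfolding inverse_eq_divide by linarith
    finally show ?thesis .
  qed
  then show ?thesis by (auto simp: stochastic_def srw_def)
qed

lemma srw_irreducible:
  assumes "n \<ge> 2" "connected_graph n E"
  shows "irreducible_chain n (srw n E)"
  unfolding irreducible_chain_def
proof (intro allI impI)
  fix x y assume xy: "x < n" "y < n"
  let ?P = "srw n E"
  have st: "stochastic n ?P" by (rule srw_stochastic[OF assms])
  have "(\<lambda>a b. a < n \<and> b < n \<and> E a b)\<^sup>*\<^sup>* x y" using assms xy by (auto simp: connected_graph_def)
  then show "\<exists>t. mpow n ?P t x y > 0"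
  proof (induction rule: converse_rtranclp_induct)
    case base
    show ?case by (rule exI[of _ 0]) simp
  next
    case (step a b)
    then obtain t where t: "mpow n ?P t b y > 0" by blast
    have "?P a b > 0"
      using step.hyps(1) connected_graph_degree_pos[OF assms, of a] by (simp add: srw_def)
    with t have "0 < ?P a b * mpow n ?P t b y" by simp
    also have "\<dots> \<le> mpow n ?P (Suc t) a y"
      unfolding mpow.simps using step.hyps(1) st mpow_nonneg[OF st _ xy(2)]
      by (intro member_le_sum[of b "{..<n}" "\<lambda>z. ?P a z * mpow n ?P t z y"])
         (auto simp: stochastic_def)
    finally show ?case ..
  qed
qed

lemma srw_reversible:
  assumes "simple_graph n E" "regular_graph n E d"
  shows "reversible n (srw n E) (\<lambda>_. c)"
  using assms by (auto simp: reversible_def srw_def simple_graph_def regular_graph_def)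

text \<open>The logarithm splits as \<open>ln 2 + 1 + ln n\<close>, where
  \<open>ln 2 \<le> ln n\<close> and \<open>1 \<le> 2 * ln 2 \<le> 2 * ln n\<close>.\<close>

lemma ln_two_exp_le:
  assumes "n \<ge> (2::nat)"
  shows "ln (2 * exp 1 * real n) \<le> 4 * ln (real n)"
proof -
  have "exp 1 \<le> (2::real)\<^sup>2" using exp_le by simp
  then have "ln (exp 1) \<le> ln ((2::real)\<^sup>2)" by (intro ln_mono) auto
  then have "1 \<le> 2 * ln (2::real)" using ln_realpow[of 2 2] by simp
  moreover have "ln 2 \<le> ln (real n)" using assms by (intro ln_mono) auto
  moreover have "ln (2 * exp 1 * real n) = ln 2 + 1 + ln (real n)"
    using assms by (simp add: ln_mult)
  ultimately show ?thesis by linarith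
qed

lemma poincare_chain_srw:
  assumes "n \<ge> 2" "simple_graph n E" "regular_graph n E d" "connected_graph n E"
  shows "poincare_chain n (srw n E) (\<lambda>_. 1 / real n)
    (1 - (if aperiodic_chain n (srw n E) then slem n (srw n E) else slem n (lazy (srw n E))))"
proof -
  have "reversible_chain n (srw n E) (\<lambda>_. 1 / real n)"
    using assms srw_stochastic srw_reversible by unfold_locales auto
  then show ?thesis
    using poincare_chain_slem poincare_chain_slem_lazy assms(1) srw_irreducible[OF assms(1,4)] by auto
qed

theorem mainTheorem5:
  "\<exists>C C'. C > 0 \<and> C' > 0 \<and>
    (\<forall>(n::nat) (P::nat \<Rightarrow> nat \<Rightarrow> real) (\<pi>::nat \<Rightarrow> real) (S::nat set) x.
       n \<ge> 2 \<and> stochastic n P \<and> irreducible_chain n P \<and> aperiodic_chain n P \<and>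
       prob_on n \<pi> \<and> reversible n P \<pi> \<and>
       S \<subseteq> {..<n} \<and> S \<noteq> {} \<and> x \<in> S \<longrightarrow>
         harm_stat n P \<pi> S x
           \<le> C / (uP n P * (1 - slem n P)) * \<pi> x
               * max (ln (2 * exp 1 / pimin n \<pi>)) (1 / (\<Sum>y\<in>S. \<pi> y))
       \<and> C / (uP n P * (1 - slem n P)) * \<pi> x
               * max (ln (2 * exp 1 / pimin n \<pi>)) (1 / (\<Sum>y\<in>S. \<pi> y))
           \<le> C' * pimax n \<pi> / ((1 - slem n P)\<^sup>2 * pimin n \<pi>) * \<pi> x
               * max (ln (2 * exp 1 / pimin n \<pi>)) (1 / (\<Sum>y\<in>S. \<pi> y)))
  \<and> (\<forall>(n::nat) (E::nat \<Rightarrow> nat \<Rightarrow> bool) (d::nat) (S::nat set) x.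
       n \<ge> 2 \<and> simple_graph n E \<and> regular_graph n E d \<and> connected_graph n E \<and>
       S \<subseteq> {..<n} \<and> S \<noteq> {} \<and> x \<in> S \<longrightarrow>
       (let P = srw n E;
            lam = (if aperiodic_chain n P then slem n P else slem n (lazy P));
            \<pi> = (\<lambda>y. 1 / real n)
        in harm_stat n P \<pi> S x
             \<le> C / (uP n P * (1 - lam)) * max (1 / real (card S)) (ln (real n) / real n)
           \<and> C / (uP n P * (1 - lam)) * max (1 / real (card S)) (ln (real n) / real n)
             \<le> C' / (1 - lam)\<^sup>2 * max (1 / real (card S)) (ln (real n) / real n)))"
proof (rule exI[of _ 24], rule exI[of _ 48], intro conjI allI impI)
  fix n :: nat and P :: "nat \<Rightarrow> nat \<Rightarrow> real" and \<pi> :: "nat \<Rightarrow> real" and S :: "nat set" and x :: nat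
  assume as: "n \<ge> 2 \<and> stochastic n P \<and> irreducible_chain n P \<and> aperiodic_chain n P \<and>
       prob_on n \<pi> \<and> reversible n P \<pi> \<and>
       S \<subseteq> {..<n} \<and> S \<noteq> {} \<and> x \<in> S"
  interpret poincare_chain n P \<pi> "1 - slem n P"
    using as by (intro poincare_chain_slem reversible_chain_of_irreducible) auto
  let ?M = "max (ln (2 * exp 1 / pimin n \<pi>)) (1 / (\<Sum>y\<in>S. \<pi> y))"
  have x: "x < n" using as by auto
  have "finite S" using as finite_subset by blast
  then have "sum \<pi> S > 0" using as pi_pos by (intro sum_pos) auto
  then have M: "\<pi> x * ?M \<ge> 0" using pi_pos[OF x]
    by (intro mult_nonneg_nonneg) (auto simp: le_max_iff_disj)
  have n: "n \<ge> 2" using as by blast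
  have "harm_stat n P \<pi> S x \<le> 6 / (1 - slem n P) * (\<pi> x * ?M)"
    using harm_stat_le[of S x] as unfolding mult.assoc by blast
  also have "\<dots> \<le> 24 / (uP n P * (1 - slem n P)) * (\<pi> x * ?M)"
    by (intro mult_right_mono uP_inequalities n M)
  finally show "harm_stat n P \<pi> S x \<le> 24 / (uP n P * (1 - slem n P)) * \<pi> x * ?M"
    by (simp only: mult.assoc)
  have "24 / (uP n P * (1 - slem n P)) * (\<pi> x * ?M)
      \<le> 48 * pimax n \<pi> / ((1 - slem n P)\<^sup>2 * pimin n \<pi>) * (\<pi> x * ?M)"
    by (intro mult_right_mono uP_inequalities n M)
  then show "24 / (uP n P * (1 - slem n P)) * \<pi> x * ?M
      \<le> 48 * pimax n \<pi> / ((1 - slem n P)\<^sup>2 * pimin n \<pi>) * \<pi> x * ?M"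
    by (simp only: mult.assoc)
next
  fix n :: nat and E :: "nat \<Rightarrow> nat \<Rightarrow> bool" and d :: nat and S :: "nat set" and x :: nat
  assume as: "n \<ge> 2 \<and> simple_graph n E \<and> regular_graph n E d \<and> connected_graph n E \<and>
       S \<subseteq> {..<n} \<and> S \<noteq> {} \<and> x \<in> S"
  define P where "P = srw n E"
  define g where "g = 1 - (if aperiodic_chain n P then slem n P else slem n (lazy P))"
  define \<pi> where "\<pi> = (\<lambda>y::nat. 1 / real n)"
  interpret poincare_chain n P \<pi> g
    unfolding P_def g_def \<pi>_def using as by (intro poincare_chain_srw) auto
  let ?M = "max (1 / real (card S)) (ln (real n) / real n)"
  have n: "n \<ge> 2" using as by blast
  have "\<pi> ` {..<n} = {1 / real n}" using n_pos by (auto simp: \<pi>_def)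
  then have minmax: "pimin n \<pi> = 1 / real n" "pimax n \<pi> = 1 / real n"
    by (simp_all add: pimin_def pimax_def)
  have M: "?M \<ge> 0" by (simp add: le_max_iff_disj)
  \<comment> \<open>The weight \<open>1 / n\<close> divides the logarithm and cancels against
    \<open>sum \<pi> S = card S / n\<close>.\<close>
  have "\<pi> x * max (ln (2 * exp 1 / pimin n \<pi>)) (1 / sum \<pi> S)
      = max (ln (2 * exp 1 * real n) / real n) (1 / real (card S))"
    using n unfolding minmax by (simp add: \<pi>_def max_divide_distrib_right)
  also have "\<dots> \<le> 4 * ?M"
  proof -
    have "ln (2 * exp 1 * real n) / real n \<le> 4 * ln (real n) / real n"
      by (intro divide_right_mono ln_two_exp_le n) auto
    also have "\<dots> \<le> 4 * ?M" by simp
    moreover have "1 / real (card S) \<le> 4 * ?M" using M by (smt (verit) max.cobounded1)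
    ultimately show ?thesis by linarith
  qed
  finally have le4: "\<pi> x * max (ln (2 * exp 1 / pimin n \<pi>)) (1 / sum \<pi> S) \<le> 4 * ?M" .
  have "harm_stat n P \<pi> S x \<le> 6 / g * (\<pi> x * max (ln (2 * exp 1 / pimin n \<pi>)) (1 / sum \<pi> S))"
    using harm_stat_le[of S x] as unfolding mult.assoc by blast
  also have "\<dots> \<le> 6 / g * (4 * ?M)"
    using gap_pos le4 by (intro mult_left_mono) auto
  also have "\<dots> \<le> 24 / (uP n P * g) * ?M"
  proof -
    have "uP n P \<le> 1" "0 < uP n P" using uP_bounds[OF n] by auto
    then have "24 / g \<le> 24 / (uP n P * g)" using gap_pos by (simp add: field_simps)
    from mult_right_mono[OF this M] show ?thesis by simp
  qed
  finally have 1: "harm_stat n P \<pi> S x \<le> 24 / (uP n P * g) * ?M" .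
  \<comment> \<open>For the uniform measure the ratio of \<open>pimax\<close> to
    \<open>pimin\<close> is 1.\<close>
  have "24 / (uP n P * g) \<le> 48 / g\<^sup>2"
    using uP_inequalities(2)[OF n] n unfolding minmax by simp
  then have 2: "24 / (uP n P * g) * ?M \<le> 48 / g\<^sup>2 * ?M" by (intro mult_right_mono M)
  show "let P = srw n E;
            lam = (if aperiodic_chain n P then slem n P else slem n (lazy P));
            \<pi> = (\<lambda>y. 1 / real n)
        in harm_stat n P \<pi> S x
             \<le> 24 / (uP n P * (1 - lam)) * max (1 / real (card S)) (ln (real n) / real n)
           \<and> 24 / (uP n P * (1 - lam)) * max (1 / real (card S)) (ln (real n) / real n)
             \<le> 48 / (1 - lam)\<^sup>2 * max (1 / real (card S)) (ln (real n) / real n)"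
    using 1 2 unfolding Let_def P_def[symmetric] g_def[symmetric] \<pi>_def[symmetric] by blast
qed auto

end
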